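(* For every integer $\Delta \geq 1$, every (finite, simple) graph with maximum degree $\Delta$ has separation dimension less than $20\Delta$.
   Context: For a graph $G$, a function $f:V(G)\to\mathbb{R}^d$ is separating if for all pairs of disjoint edges $vw,xy\in E(G)$ there is an axis-parallel hyperplane separating the point pair $\{f(v),f(w)\}$ from $\{f(x),f(y)\}$. The separation dimension of $G$ is the minimum positive integer $d$ for which $G$ has a separating function into $\mathbb{R}^d$. Equivalently: edges $e,f$ are separated in a linear ordering of $V(G)$ if both endpoints of $e$ precede both endpoints of $f$ or vice versa; a representation of $G$ is a non-empty set of linear orderings of $V(G)$; it is separating if every pair of disjoint edges is separated in at least one of its orderings; the separation dimension is the minimum size of a separating representation. *)

theory Defs
  imports Complex_Main
begin

definition simple_graph :: "'a set \<Rightarrow> 'a set set \<Rightarrow> bool" where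
  "simple_graph V E \<longleftrightarrow> finite V \<and> (\<forall>e\<in>E. e \<subseteq> V \<and> card e = 2)"

definition degree :: "'a set set \<Rightarrow> 'a \<Rightarrow> nat" where
  "degree E v = card {e \<in> E. v \<in> e}"

(* The 0 only matters for the graph without vertices. *)
definition max_degree :: "'a set \<Rightarrow> 'a set set \<Rightarrow> nat" where
  "max_degree V E = Max (insert 0 (degree E ` V))"

(* The points p v, p w (with e = {v, w}) and p x, p y (with e' = {x, y}) lie strictly on
   opposite sides of the hyperplane with equation "i-th coordinate = c". *)
definition separated_by ::
    "('a \<Rightarrow> nat \<Rightarrow> real) \<Rightarrow> nat \<Rightarrow> real \<Rightarrow> 'a set \<Rightarrow> 'a set \<Rightarrow> bool" where
  "separated_by p i c e e' \<longleftrightarrow>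
     (\<forall>v\<in>e. \<forall>x\<in>e'. p v i < c \<and> c < p x i) \<or> (\<forall>v\<in>e. \<forall>x\<in>e'. p x i < c \<and> c < p v i)"

(* A point of R^d is given by its coordinates 0, ..., d - 1; the values of p v at
   indices i \<ge> d and the values of p outside the vertex set play no role. *)
definition separating :: "'a set set \<Rightarrow> nat \<Rightarrow> ('a \<Rightarrow> nat \<Rightarrow> real) \<Rightarrow> bool" where
  "separating E d p \<longleftrightarrow>
     (\<forall>e\<in>E. \<forall>e'\<in>E. e \<inter> e' = {} \<longrightarrow> (\<exists>i<d. \<exists>c. separated_by p i c e e'))"

(* Depends on V only through E, since separation concerns the edges alone. *)
definition separation_dimension :: "'a set set \<Rightarrow> nat" where
  "separation_dimension E = (LEAST d. d > 0 \<and> (\<exists>p. separating E d p))"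

(* The minimum is attained for every finite graph, so LEAST is meaningful. *)
lemma separating_exists:
  assumes "simple_graph V E"
  shows "\<exists>d>0. \<exists>p. separating E d p"
proof -
  have "E \<subseteq> Pow V" "finite V"
    using assms by (auto simp: simple_graph_def)
  then have "finite E"
    by (meson finite_Pow_iff finite_subset)
  then obtain es where es: "set es = E"
    using finite_list by blast
  have "separating E (Suc (length es)) (\<lambda>v i. if v \<in> es ! i then 1 else 0)"
    unfolding separating_def
  proof (intro ballI impI)
    fix e e' assume e: "e \<in> E" "e' \<in> E" "e \<inter> e' = {}"
    then obtain i where i: "i < length es" "es ! i = e"
      using es by (metis in_set_conv_nth)
    have "separated_by (\<lambda>v i. if v \<in> es ! i then 1 else 0) i (1/2) e e'"
      using i e by (auto simp: separated_by_def)
    then show "\<exists>i<Suc (length es). \<exists>c.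
        separated_by (\<lambda>v i. if v \<in> es ! i then 1 else 0) i c e e'"
      using i by (meson less_SucI)
  qed
  then show ?thesis by blast
qed

end

(* Colour the vertices properly with r colours and write the colour sum of an edge for the sum of
   its two colours mod r. Edges with colour sum m join each colour i only to colour m - i, so one
   coordinate per m, constant on the components of the graph of these edges, separates any two of
   them in different components. Two edges with different colour sums have different pairs of
   colours, and O(log r) random orderings of the colours, in which every colour class is listed
   forwards or backwards, separate them. There remain disjoint edges in the same component. All paths
   in such a component alternate between two colours, and a counting argument in the style of
   Rosenfeld gives a colouring with r = 6 \<Delta> colours without alternating paths on 2 h
   vertices, where h is of order log \<Delta>. So the remaining pairs of edges lie within distance
   2 h - 2 and are separated by random orderings of the colours of a distance colouring.
   For \<Delta> \<le> 13 the logarithmic terms are too large; there the square of the graph is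
   coloured with \<Delta>\<^sup>2 + 1 colours, and every component is a single edge. *)

theory Submission
  imports Defs "HOL-Combinatorics.Permutations"
begin

section \<open>Avoiding forbidden assignments\<close>

text \<open>Induction over \<open>S \<subseteq> V\<close> shows that adding a vertex multiplies the number of good
  assignments by at least \<open>\<beta>\<close>: an extension that becomes bad through \<open>j\<close> is determined by
  its restriction outside \<open>D j\<close>, and by induction removing \<open>D j\<close> divides the number of
  good assignments by at least \<open>\<beta> ^ (card (D j) - 1)\<close>.\<close>

lemma exists_avoiding_assignment:
  fixes supp D :: "'i \<Rightarrow> 'a set" and bad :: "'i \<Rightarrow> ('a \<Rightarrow> 'c) \<Rightarrow> bool" and \<beta> :: real
  assumes "finite V" "finite A" "\<beta> > 0"
    and supp: "\<And>i. i \<in> I \<Longrightarrow> supp i \<noteq> {}"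
    and cong: "\<And>i c c'. bad i c \<Longrightarrow> (\<And>x. x \<in> supp i \<Longrightarrow> c x = c' x) \<Longrightarrow> bad i c'"
    and finJ: "\<And>v. v \<in> V \<Longrightarrow> finite (J v)"
    and cover: "\<And>v i c. v \<in> V \<Longrightarrow> i \<in> I \<Longrightarrow> supp i \<subseteq> V \<Longrightarrow> v \<in> supp i \<Longrightarrow> bad i c \<Longrightarrow>
      \<exists>j\<in>J v. supp j \<subseteq> supp i \<and> bad j c"
    and D: "\<And>v j. v \<in> V \<Longrightarrow> j \<in> J v \<Longrightarrow> v \<in> D j \<and> D j \<subseteq> supp j"
    and det: "\<And>v j c c' x. v \<in> V \<Longrightarrow> j \<in> J v \<Longrightarrow> bad j c \<Longrightarrow> bad j c' \<Longrightarrow>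
      (\<And>y. y \<in> supp j - D j \<Longrightarrow> c y = c' y) \<Longrightarrow> x \<in> D j \<Longrightarrow> c x = c' x"
    and weight: "\<And>v. v \<in> V \<Longrightarrow> \<beta> + (\<Sum>j\<in>J v. (1 / \<beta>) ^ (card (D j) - 1)) \<le> card A"
  obtains c where "\<And>v. v \<in> V \<Longrightarrow> c v \<in> A" "\<And>i. i \<in> I \<Longrightarrow> supp i \<subseteq> V \<Longrightarrow> \<not> bad i c"
proof -
  define G where "G S = {c \<in> S \<rightarrow>\<^sub>E A. \<forall>i\<in>I. supp i \<subseteq> S \<longrightarrow> \<not> bad i c}" for S
  have finG: "finite (G S)" if "S \<subseteq> V" for S
    using that assms(1,2) finite_subset unfolding G_def
    by (intro finite_subset[OF _ finite_PiE[of S "\<lambda>_. A"]]) auto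
  have bad_restrict: "bad i (restrict c T) \<longleftrightarrow> bad i c" if "supp i \<subseteq> T" for i c T
    using that cong[of i "restrict c T" c] cong[of i c "restrict c T"] by (auto simp: subset_iff)
  have hered: "restrict c T \<in> G T" if "c \<in> G S" "T \<subseteq> S" for c S T
    using that by (auto simp: G_def bad_restrict dest!: PiE_mem)
  have step: "\<beta> * card (G S) \<le> card (G (insert v S))" if "S \<subseteq> V" "v \<in> V - S" for S v
    using finite_subset[OF \<open>S \<subseteq> V\<close> \<open>finite V\<close>] that
  proof (induction S arbitrary: v rule: finite_psubset_induct)
    case (psubset S)
    let ?g = "real (card (G S))"
    have rem: "real (card (G (S - F))) \<le> (1 / \<beta>) ^ card F * ?g" if "F \<subseteq> S" for F
      using finite_subset[OF that \<open>finite S\<close>] that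
    proof (induction F)
      case (insert x F)
      have "\<beta> * card (G (S - insert x F)) \<le> card (G (insert x (S - insert x F)))"
        using insert psubset by (intro psubset.IH) auto
      also have "insert x (S - insert x F) = S - F"
        using insert by auto
      also have "real (card (G (S - F))) \<le> (1 / \<beta>) ^ card F * ?g"
        using insert by auto
      finally show ?case
        using insert \<open>\<beta> > 0\<close> by (simp add: field_simps)
    qed simp
    define Ext where "Ext = (\<lambda>(a, g). g(v := a)) ` (A \<times> G S)"
    have "inj_on (\<lambda>(a, g). g(v := a)) (A \<times> G S)"
      using psubset.prems inj_combinator[of v S "\<lambda>_. A"] by (rule_tac inj_on_subset) (auto simp: G_def)
    then have card_Ext: "card Ext = card A * card (G S)"
      by (simp add: Ext_def card_image card_cartesian_product)
    have fin_Ext: "finite Ext"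
      unfolding Ext_def using finG psubset.prems \<open>finite A\<close> by auto
    have Ext_PiE: "c \<in> insert v S \<rightarrow>\<^sub>E A" if "c \<in> Ext" for c
      using that by (auto simp: Ext_def G_def PiE_insert_eq)
    have Ext_G: "restrict c S \<in> G S" if "c \<in> Ext" for c
    proof -
      obtain a g where ag: "c = g(v := a)" "g \<in> G S"
        using \<open>c \<in> Ext\<close> unfolding Ext_def by fast
      have "restrict c S = restrict g S"
        using ag psubset.prems by auto
      then show ?thesis
        using hered[OF ag(2)] by simp
    qed
    let ?B = "\<lambda>j. {c \<in> Ext. supp j \<subseteq> insert v S \<and> bad j c}"
    have vV: "v \<in> V" and vS: "insert v S \<subseteq> V" "v \<notin> S"
      using psubset.prems by auto
    have cover_Ext: "Ext \<subseteq> G (insert v S) \<union> (\<Union>j\<in>J v. ?B j)"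
    proof
      fix c assume c: "c \<in> Ext"
      show "c \<in> G (insert v S) \<union> (\<Union>j\<in>J v. ?B j)"
      proof (cases "c \<in> G (insert v S)")
        case False
        then obtain i where i: "i \<in> I" "supp i \<subseteq> insert v S" "bad i c"
          using Ext_PiE[OF c] by (auto simp: G_def)
        have "v \<in> supp i"
        proof (rule ccontr)
          assume "v \<notin> supp i"
          then have "supp i \<subseteq> S" using i by auto
          then show False
            using Ext_G[OF c] i bad_restrict[of i S c] by (auto simp: G_def)
        qed
        then obtain j where "j \<in> J v" "supp j \<subseteq> supp i" "bad j c"
          using cover[OF vV i(1) _ _ i(3)] i vS by blast
        then show ?thesis
          using c i by auto
      qed simp
    qed
    have B: "real (card (?B j)) \<le> (1 / \<beta>) ^ (card (D j) - 1) * ?g" if j: "j \<in> J v" for j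
    proof (cases "supp j \<subseteq> insert v S")
      case True
      let ?T = "insert v S - D j"
      have T: "?T = S - (D j - {v})" "D j - {v} \<subseteq> S" "v \<in> D j" "D j \<subseteq> supp j"
        using D[OF vV j] True vS by auto
      have finD: "finite (D j)"
        using finite_subset[OF T(2) \<open>finite S\<close>] by simp
      have "inj_on (\<lambda>c. restrict c ?T) (?B j)"
      proof (intro inj_onI)
        fix c c' assume c: "c \<in> ?B j" "c' \<in> ?B j" and eq: "restrict c ?T = restrict c' ?T"
        have agree: "c y = c' y" if "y \<in> ?T" for y
          using fun_cong[OF eq, of y] that by simp
        have "c x = c' x" if "x \<in> D j" for x
        proof (rule det[OF vV j _ _ _ that])
          show "bad j c" "bad j c'"
            using c by auto
          show "c y = c' y" if "y \<in> supp j - D j" for y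
            using that True by (intro agree) auto
        qed
        then show "c = c'"
          using c agree Ext_PiE by (intro PiE_ext[of c "insert v S" "\<lambda>_. A"]) blast+
      qed
      moreover have "(\<lambda>c. restrict c ?T) ` ?B j \<subseteq> G ?T"
      proof (intro image_subsetI)
        fix c assume "c \<in> ?B j"
        then have "c \<in> Ext" by simp
        moreover have "?T \<subseteq> S" using T by auto
        ultimately have "restrict (restrict c S) ?T \<in> G ?T"
          by (rule hered[OF Ext_G])
        moreover have "restrict (restrict c S) ?T = restrict c ?T"
          using \<open>?T \<subseteq> S\<close> by (simp add: Int_absorb1)
        ultimately show "restrict c ?T \<in> G ?T" by simp
      qed
      ultimately have "card (?B j) \<le> card (G ?T)"
        using vS by (intro card_inj_on_le finG) auto
      also have "real (card (G ?T)) \<le> (1 / \<beta>) ^ card (D j - {v}) * ?g"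
        unfolding T(1) by (rule rem[OF T(2)])
      finally show ?thesis
        using T finD by simp
    qed (use \<open>\<beta> > 0\<close> in simp)
    have "card A * ?g = card Ext"
      by (simp add: card_Ext)
    also have "\<dots> \<le> card (G (insert v S) \<union> (\<Union>j\<in>J v. ?B j))"
      using finG[OF vS(1)] fin_Ext finJ[OF vV] by (intro of_nat_mono card_mono[OF _ cover_Ext]) auto
    also have "\<dots> \<le> card (G (insert v S)) + (\<Sum>j\<in>J v. card (?B j))"
      by (intro of_nat_mono order.trans[OF card_Un_le] add_left_mono card_UN_le finJ[OF vV])
    also have "\<dots> = card (G (insert v S)) + (\<Sum>j\<in>J v. real (card (?B j)))"
      by simp
    also have "\<dots> \<le> card (G (insert v S)) + (\<Sum>j\<in>J v. (1 / \<beta>) ^ (card (D j) - 1) * ?g)"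
      by (intro add_left_mono sum_mono B)
    also have "\<dots> = card (G (insert v S)) + (\<Sum>j\<in>J v. (1 / \<beta>) ^ (card (D j) - 1)) * ?g"
      by (simp add: sum_distrib_right)
    finally have "card A * ?g \<le> card (G (insert v S)) + (\<Sum>j\<in>J v. (1 / \<beta>) ^ (card (D j) - 1)) * ?g" .
    moreover have "(\<beta> + (\<Sum>j\<in>J v. (1 / \<beta>) ^ (card (D j) - 1))) * ?g \<le> card A * ?g"
      by (intro mult_right_mono weight[OF vV]) simp
    ultimately show ?case
      by (simp add: distrib_right)
  qed
  have "card (G S) > 0" if "S \<subseteq> V" for S
    using finite_subset[OF that \<open>finite V\<close>] that
  proof (induction S)
    case empty
    have "G {} = {\<lambda>_. undefined}"
      using supp by (auto simp: G_def)
    then show ?case by simp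
  next
    case (insert v S)
    then have "0 < \<beta> * card (G S)"
      using \<open>\<beta> > 0\<close> by simp
    also have "\<dots> \<le> card (G (insert v S))"
      using insert by (intro step) auto
    finally show ?case by simp
  qed
  then obtain c where "c \<in> G V"
    by (metis card.empty equals0I less_irrefl order_refl)
  then show ?thesis
    by (intro that[of c]) (auto simp: G_def)
qed

section \<open>Colourings without long alternating paths\<close>

lemma exists_greedy_colouring:
  fixes R :: "('a \<times> 'a) set"
  assumes "finite V" "sym R"
    and deg: "\<And>v. v \<in> V \<Longrightarrow> finite (R `` {v}) \<and> card (R `` {v} - {v}) < K"
  obtains c :: "'a \<Rightarrow> nat" where "\<And>v. v \<in> V \<Longrightarrow> c v < K"
    "\<And>v w. v \<in> V \<Longrightarrow> w \<in> V \<Longrightarrow> v \<noteq> w \<Longrightarrow> (v, w) \<in> R \<Longrightarrow> c v \<noteq> c w"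
proof -
  have J: "1 + (\<Sum>j\<in>{v} \<times> (R `` {v} - {v}). (1 / 1) ^ (card {fst j} - 1)) \<le> real (card {..<K})"
    if "v \<in> V" for v
    using deg[OF that] by (simp add: card_cartesian_product)
  obtain c :: "'a \<Rightarrow> nat" where c: "\<And>v. v \<in> V \<Longrightarrow> c v \<in> {..<K}"
    "\<And>i. i \<in> R - Id \<Longrightarrow> {fst i, snd i} \<subseteq> V \<Longrightarrow> \<not> c (fst i) = c (snd i)"
  proof (rule exists_avoiding_assignment[where V = V and A = "{..<K}" and \<beta> = 1 and I = "R - Id"
        and supp = "\<lambda>i. {fst i, snd i}" and D = "\<lambda>i. {fst i}" and J = "\<lambda>v. {v} \<times> (R `` {v} - {v})"
        and bad = "\<lambda>i c. c (fst i) = c (snd i)"])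
    show "\<exists>j\<in>{v} \<times> (R `` {v} - {v}). {fst j, snd j} \<subseteq> {fst i, snd i} \<and> c (fst j) = c (snd j)"
      if "i \<in> R - Id" "v \<in> {fst i, snd i}" "c (fst i) = c (snd i)" for v i and c :: "'a \<Rightarrow> nat"
    proof -
      obtain a b where "i = (a, b)" by fastforce
      then show ?thesis
        using that \<open>sym R\<close> by (auto dest: symD)
    qed
    show "c x = c' x"
      if "j \<in> {v} \<times> (R `` {v} - {v})" "c (fst j) = c (snd j)" "c' (fst j) = c' (snd j)"
        and "\<And>y. y \<in> {fst j, snd j} - {fst j} \<Longrightarrow> c y = c' y" "x \<in> {fst j}"
      for v j x and c c' :: "'a \<Rightarrow> nat"
    proof -
      have "snd j \<noteq> fst j" using that(1) by auto
      then have "c (snd j) = c' (snd j)" by (intro that(4)) simp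
      then show ?thesis using that(2,3,5) by simp
    qed
  qed (use J assms in auto)
  show ?thesis
    by (rule that[of c]) (use c(1) c(2)[of "(v, w)" for v w] in auto)
qed

definition neighbours :: "'a set set \<Rightarrow> 'a \<Rightarrow> 'a set" where
  "neighbours E v = {w. {v, w} \<in> E}"

abbreviation walk :: "'a set set \<Rightarrow> 'a list \<Rightarrow> bool" where
  "walk E \<equiv> successively (\<lambda>x y. {x, y} \<in> E)"

lemma walk_rev: "walk E (rev xs) \<longleftrightarrow> walk E xs"
  by (simp add: insert_commute)

lemma card_walks_from:
  assumes "\<And>v. finite (neighbours E v) \<and> card (neighbours E v) \<le> \<Delta>"
  shows "finite {xs. length xs = Suc n \<and> hd xs = v \<and> walk E xs} \<and>
    card {xs. length xs = Suc n \<and> hd xs = v \<and> walk E xs} \<le> \<Delta> ^ n"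
proof (induction n arbitrary: v)
  case 0
  have "{xs. length xs = Suc 0 \<and> hd xs = v \<and> walk E xs} = {[v]}"
    by (auto simp: length_Suc_conv)
  then show ?case by simp
next
  case (Suc n)
  let ?W = "\<lambda>n v. {xs. length xs = Suc n \<and> hd xs = v \<and> walk E xs}"
  have sub: "?W (Suc n) v \<subseteq> (\<Union>w\<in>neighbours E v. (#) v ` ?W n w)"
    by (auto simp: length_Suc_conv neighbours_def)
  have fin: "finite (\<Union>w\<in>neighbours E v. (#) v ` ?W n w)"
    using Suc.IH assms by simp
  have "card (?W (Suc n) v) \<le> card (\<Union>w\<in>neighbours E v. (#) v ` ?W n w)"
    by (rule card_mono[OF fin sub])
  also have "\<dots> \<le> (\<Sum>w\<in>neighbours E v. card ((#) v ` ?W n w))"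
    using assms by (intro card_UN_le) simp
  also have "\<dots> \<le> (\<Sum>w\<in>neighbours E v. \<Delta> ^ n)"
  proof (rule sum_mono)
    show "card ((#) v ` ?W n w) \<le> \<Delta> ^ n" for w
      using card_image_le[of "?W n w" "(#) v"] Suc.IH[of w] by linarith
  qed
  also have "\<dots> \<le> \<Delta> * \<Delta> ^ n"
    using assms by simp
  finally show ?case
    using finite_subset[OF sub fin] by simp
qed

lemma card_walks_at:
  assumes "\<And>v. finite (neighbours E v) \<and> card (neighbours E v) \<le> \<Delta>" and "p < L"
  shows "finite {xs. length xs = L \<and> walk E xs \<and> xs ! p = v} \<and>
    card {xs. length xs = L \<and> walk E xs \<and> xs ! p = v} \<le> \<Delta> ^ (L - 1)"
proof -
  let ?W = "\<lambda>n. {xs. length xs = Suc n \<and> hd xs = v \<and> walk E xs}"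
  let ?S = "{xs. length xs = L \<and> walk E xs \<and> xs ! p = v}"
  let ?f = "\<lambda>xs. (rev (take (Suc p) xs), drop p xs)"
  have W: "finite (?W n) \<and> card (?W n) \<le> \<Delta> ^ n" for n
    by (rule card_walks_from[OF assms(1)])
  have sub: "?f ` ?S \<subseteq> ?W p \<times> ?W (L - 1 - p)"
  proof (intro image_subsetI)
    fix xs assume xs: "xs \<in> ?S"
    have "walk E (take (Suc p) xs @ drop (Suc p) xs)" "walk E (take p xs @ drop p xs)"
      using xs by auto
    then have "walk E (take (Suc p) xs)" "walk E (drop p xs)"
      by (auto simp only: successively_append_iff)
    moreover have "hd (rev (take (Suc p) xs)) = v" "hd (drop p xs) = v"
      using xs \<open>p < L\<close> by (auto simp: hd_drop_conv_nth hd_rev take_Suc_conv_app_nth)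
    ultimately show "?f xs \<in> ?W p \<times> ?W (L - 1 - p)"
      using xs \<open>p < L\<close> walk_rev[of E "take (Suc p) xs"] by (auto simp del: successively_rev)
  qed
  have inj: "inj_on ?f ?S"
  proof (rule inj_onI)
    fix xs ys assume "?f xs = ?f ys"
    then have eq: "take (Suc p) xs = take (Suc p) ys" "drop p xs = drop p ys"
      by auto
    have "take p (take (Suc p) xs) = take p (take (Suc p) ys)"
      by (simp only: eq)
    then have "take p xs = take p ys"
      by (simp add: min_def)
    then show "xs = ys"
      using eq(2) by (metis append_take_drop_id)
  qed
  have "card ?S \<le> card (?W p \<times> ?W (L - 1 - p))"
    using inj sub W by (intro card_inj_on_le) auto
  also have "\<dots> \<le> \<Delta> ^ p * \<Delta> ^ (L - 1 - p)"
    unfolding card_cartesian_product using W by (intro mult_mono) auto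
  also have "\<dots> = \<Delta> ^ (L - 1)"
    using \<open>p < L\<close> by (simp flip: power_add)
  finally show ?thesis
    using inj_on_finite[OF inj sub] W by simp
qed

definition alternating :: "('a \<Rightarrow> 'c) \<Rightarrow> 'a list \<Rightarrow> bool" where
  "alternating c xs \<longleftrightarrow> (\<forall>i. i + 2 < length xs \<longrightarrow> c (xs ! i) = c (xs ! (i + 2)))"

lemma alternating_rev:
  assumes "alternating c xs"
  shows "alternating c (rev xs)"
  unfolding alternating_def
proof (intro allI impI)
  fix i assume "i + 2 < length (rev xs)"
  moreover from this have "Suc (length xs - Suc (Suc (Suc i))) + 1 = length xs - Suc i"
    by simp
  ultimately show "c (rev xs ! i) = c (rev xs ! (i + 2))"
    using assms[unfolded alternating_def, rule_format, of "length xs - Suc (i + 2)"]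
    by (simp add: rev_nth)
qed

lemma alternating_determined:
  assumes "alternating c xs" "alternating c' xs" "distinct xs"
    and agree: "\<And>y. y \<in> set xs - set (take (length xs - 2) xs) \<Longrightarrow> c y = c' y"
    and "x \<in> set xs"
  shows "c x = c' x"
proof -
  have "c (xs ! i) = c' (xs ! i)" if "i < length xs" for i
    using that
  proof (induction "length xs - i" arbitrary: i rule: less_induct)
    case less
    show ?case
    proof (cases "i + 2 < length xs")
      case True
      then have "c (xs ! (i + 2)) = c' (xs ! (i + 2))"
        by (intro less) auto
      then show ?thesis
        using True assms(1,2) by (simp add: alternating_def)
    next
      case False
      have "xs ! i \<notin> set (take (length xs - 2) xs)"
        using False less.prems \<open>distinct xs\<close> by (auto simp: in_set_conv_nth nth_eq_iff_index_eq)
      then show ?thesis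
        using less.prems by (intro agree) auto
    qed
  qed
  then show ?thesis
    using \<open>x \<in> set xs\<close> by (auto simp: in_set_conv_nth)
qed

text \<open>Counting with \<open>\<beta> = 4 * \<Delta>\<close>. A path through a new vertex \<open>v\<close> can be reversed so that \<open>v\<close> is in
  its first half; its last two vertices then avoid \<open>v\<close> and determine the other colours.\<close>

lemma exists_path_colouring:
  assumes "finite V"
    and deg: "\<And>v. finite (neighbours E v) \<and> card (neighbours E v) \<le> \<Delta>"
    and loopless: "\<And>v. {v} \<notin> E"
    and "\<Delta> \<ge> 1" "h \<ge> 2" and h: "h * \<Delta> \<le> 4 ^ (2 * h - 3)"
  obtains c :: "'a \<Rightarrow> nat" where "\<And>v. v \<in> V \<Longrightarrow> c v < 6 * \<Delta>"
    "\<And>v w. v \<in> V \<Longrightarrow> w \<in> V \<Longrightarrow> {v, w} \<in> E \<Longrightarrow> c v \<noteq> c w"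
    "\<And>xs. set xs \<subseteq> V \<Longrightarrow> distinct xs \<Longrightarrow> walk E xs \<Longrightarrow> length xs = 2 * h \<Longrightarrow> \<not> alternating c xs"
proof -
  define P where "P = {xs. distinct xs \<and> walk E xs \<and> length xs = 2 * h}"
  define I where "I = {xs. length xs = 2 \<and> walk E xs} \<union> P"
  define bad where "bad xs c \<longleftrightarrow> (if length xs = 2 then c (xs ! 0) = c (xs ! 1) else alternating c xs)"
    for xs and c :: "'a \<Rightarrow> nat"
  define D where "D xs = (if length xs = 2 then {hd xs} else set (take (length xs - 2) xs))" for xs :: "'a list"
  define J1 where "J1 v = (\<lambda>w. [v, w]) ` neighbours E v" for v
  define J2 where "J2 v = (\<Union>p<h. {xs \<in> P. xs ! p = v})" for v
  have len: "length xs = 2" if "xs \<in> J1 v" for xs v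
    using that by (auto simp: J1_def)
  have len2: "length xs = 2 * h" "2 * h \<noteq> 2" if "xs \<in> J2 v" for xs v
    using that \<open>h \<ge> 2\<close> by (auto simp: J2_def P_def)
  have finJ1: "finite (J1 v)" and cardJ1: "card (J1 v) \<le> \<Delta>" for v
    using deg[of v] card_image_le[of "neighbours E v" "\<lambda>w. [v, w]"] by (auto simp: J1_def)
  have slice: "finite {xs \<in> P. xs ! p = v} \<and> card {xs \<in> P. xs ! p = v} \<le> \<Delta> ^ (2 * h - 1)" if "p < h" for p v
  proof -
    have sub: "{xs \<in> P. xs ! p = v} \<subseteq> {xs. length xs = 2 * h \<and> walk E xs \<and> xs ! p = v}"
      by (auto simp: P_def)
    have at: "finite {xs. length xs = 2 * h \<and> walk E xs \<and> xs ! p = v} \<and>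
      card {xs. length xs = 2 * h \<and> walk E xs \<and> xs ! p = v} \<le> \<Delta> ^ (2 * h - 1)"
      using that by (intro card_walks_at deg) simp
    show ?thesis
      using finite_subset[OF sub] card_mono[OF _ sub] at by (meson order.trans)
  qed
  have finJ2: "finite (J2 v)" for v
    unfolding J2_def using slice by auto
  have cardJ2: "card (J2 v) \<le> h * \<Delta> ^ (2 * h - 1)" for v
  proof -
    have "card (J2 v) \<le> (\<Sum>p<h. card {xs \<in> P. xs ! p = v})"
      unfolding J2_def by (intro card_UN_le) simp
    also have "\<dots> \<le> (\<Sum>p<h. \<Delta> ^ (2 * h - 1))"
      using slice by (intro sum_mono) simp
    finally show ?thesis by simp
  qed
  let ?\<beta> = "4 * real \<Delta>"
  have weight: "?\<beta> + (\<Sum>j\<in>J1 v \<union> J2 v. (1 / ?\<beta>) ^ (card (D j) - 1)) \<le> card {..<6 * \<Delta>}" for v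
  proof -
    have "(\<Sum>j\<in>J1 v. (1 / ?\<beta>) ^ (card (D j) - 1)) = card (J1 v)"
      using len by (simp add: D_def)
    also have "\<dots> \<le> real \<Delta>"
      using cardJ1 by simp
    finally have 1: "(\<Sum>j\<in>J1 v. (1 / ?\<beta>) ^ (card (D j) - 1)) \<le> real \<Delta>" .
    have "card (D j) = 2 * h - 2" if "j \<in> J2 v" for j
      using that len2[OF that] by (auto simp: D_def J2_def P_def distinct_card)
    then have "(\<Sum>j\<in>J2 v. (1 / ?\<beta>) ^ (card (D j) - 1)) = card (J2 v) * (1 / ?\<beta>) ^ (2 * h - 3)"
      by (simp add: numeral_3_eq_3 numeral_2_eq_2)
    also have "\<dots> \<le> real (h * \<Delta> ^ (2 * h - 1)) * (1 / ?\<beta>) ^ (2 * h - 3)"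
      using cardJ2 of_nat_mono by (intro mult_right_mono) (blast, simp)
    also have "\<dots> = \<Delta> * (real (h * \<Delta>) / 4 ^ (2 * h - 3))"
    proof -
      have "2 * h - 1 = Suc (Suc (2 * h - 3))"
        using \<open>h \<ge> 2\<close> by simp
      then show ?thesis
        using \<open>\<Delta> \<ge> 1\<close> by (simp add: power_mult_distrib power_divide field_simps)
    qed
    also have "\<dots> \<le> real \<Delta> * 1"
      using of_nat_mono[OF h, where 'a = real] by (intro mult_left_mono) auto
    finally have 2: "(\<Sum>j\<in>J2 v. (1 / ?\<beta>) ^ (card (D j) - 1)) \<le> real \<Delta>" by simp
    have "J1 v \<inter> J2 v = {}"
      using len len2 by fastforce
    then show ?thesis
      using 1 2 finJ1 finJ2 by (simp add: sum.union_disjoint)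
  qed
  obtain c where c: "\<And>v. v \<in> V \<Longrightarrow> c v \<in> {..<6 * \<Delta>}" "\<And>xs. xs \<in> I \<Longrightarrow> set xs \<subseteq> V \<Longrightarrow> \<not> bad xs c"
  proof (rule exists_avoiding_assignment[where V = V and A = "{..<6 * \<Delta>}" and \<beta> = ?\<beta> and I = I
        and supp = set and D = D and J = "\<lambda>v. J1 v \<union> J2 v" and bad = bad])
    show "set xs \<noteq> {}" if "xs \<in> I" for xs
      using that \<open>h \<ge> 2\<close> by (auto simp: I_def P_def)
    show "bad xs c'" if "bad xs c" "\<And>x. x \<in> set xs \<Longrightarrow> c x = c' x" for xs c c'
      using that by (auto simp: bad_def alternating_def)
    show "\<exists>ys\<in>J1 v \<union> J2 v. set ys \<subseteq> set xs \<and> bad ys c" if "xs \<in> I" "v \<in> set xs" "bad xs c" for v xs c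
    proof (cases "xs \<in> P")
      case True
      then have "length xs = 2 * h" "length xs \<noteq> 2"
        using \<open>h \<ge> 2\<close> by (auto simp: P_def)
      obtain p where p: "p < 2 * h" "xs ! p = v"
        using \<open>v \<in> set xs\<close> \<open>length xs = 2 * h\<close> by (auto simp: in_set_conv_nth)
      show ?thesis
      proof (cases "p < h")
        case True
        then show ?thesis
          using that p \<open>xs \<in> P\<close> by (intro bexI[of _ xs]) (auto simp: J2_def)
      next
        case False
        have "rev xs \<in> P"
          using \<open>xs \<in> P\<close> walk_rev[of E xs] by (simp add: P_def del: successively_rev)
        moreover have "rev xs ! (2 * h - Suc p) = v" "2 * h - Suc p < h"
          using p False \<open>length xs = 2 * h\<close> by (auto simp: rev_nth)
        ultimately have "rev xs \<in> J2 v"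
          by (auto simp: J2_def)
        moreover have "bad (rev xs) c"
          using \<open>bad xs c\<close> \<open>length xs \<noteq> 2\<close> by (simp add: bad_def alternating_rev)
        ultimately show ?thesis
          by (intro bexI[of _ "rev xs"]) auto
      qed
    next
      case False
      then obtain a b where ab: "xs = [a, b]" "{a, b} \<in> E"
        using \<open>xs \<in> I\<close> by (auto simp: I_def length_Suc_conv numeral_2_eq_2)
      have "[v, w] \<in> J1 v \<and> set [v, w] \<subseteq> set xs \<and> bad [v, w] c" if "{v, w} = {a, b}" for w
        using that ab \<open>bad xs c\<close>
        by (auto simp: J1_def neighbours_def bad_def doubleton_eq_iff insert_commute)
      moreover obtain w where "{v, w} = {a, b}"
        using \<open>v \<in> set xs\<close> ab(1) by auto
      ultimately show ?thesis by blast
    qed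
    show "v \<in> D xs \<and> D xs \<subseteq> set xs" if "xs \<in> J1 v \<union> J2 v" for v xs
    proof (cases "xs \<in> J1 v")
      case False
      then have xs: "xs \<in> J2 v" using that by simp
      then obtain p where "p < h" "xs ! p = v"
        by (auto simp: J2_def)
      then have "v \<in> set (take (length xs - 2) xs)"
        using len2[OF xs] \<open>h \<ge> 2\<close> by (auto simp: in_set_conv_nth intro!: exI[of _ p])
      then show ?thesis
        using len2[OF xs] by (auto simp: D_def dest: in_set_takeD)
    qed (auto simp: J1_def D_def)
    show "c x = c' x" if "xs \<in> J1 v \<union> J2 v" "bad xs c" "bad xs c'"
      and agree: "\<And>y. y \<in> set xs - D xs \<Longrightarrow> c y = c' y" and x: "x \<in> D xs" for v xs c c' x
    proof (cases "xs \<in> J1 v")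
      case True
      then obtain w where xs: "xs = [v, w]" "{v, w} \<in> E"
        unfolding J1_def neighbours_def by blast
      then have w: "xs = [v, w]" "v \<noteq> w"
        using loopless[of v] by (simp, metis insert_absorb2)
      then have "x = v" "c w = c' w"
        using x agree[of w] by (auto simp: D_def)
      then show ?thesis
        using that(2,3) w by (simp add: bad_def)
    next
      case False
      then have xs: "xs \<in> J2 v" using that by simp
      then have "distinct xs" by (auto simp: J2_def P_def)
      moreover have "alternating c xs" "alternating c' xs" and D: "D xs = set (take (length xs - 2) xs)"
        using that(2,3) len2[OF xs] by (simp_all add: bad_def D_def)
      moreover have "x \<in> set xs"
        using x D by (auto dest: in_set_takeD)
      ultimately show ?thesis
        using agree by (intro alternating_determined[of c xs c' x]) auto
    qed
  qed (use assms weight finJ1 finJ2 in auto)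
  show ?thesis
  proof (rule that[of c])
    show "c v < 6 * \<Delta>" if "v \<in> V" for v
      using c(1)[OF that] by simp
    show "c v \<noteq> c w" if "v \<in> V" "w \<in> V" "{v, w} \<in> E" for v w
      using c(2)[of "[v, w]"] that by (simp add: I_def bad_def)
    show "\<not> alternating c xs" if "set xs \<subseteq> V" "distinct xs" "walk E xs" "length xs = 2 * h" for xs
      using c(2)[of xs] that \<open>h \<ge> 2\<close> by (simp add: I_def P_def bad_def)
  qed
qed

section \<open>Random orderings\<close>

lemma exists_family_meeting:
  fixes \<Omega> :: "'b set" and ok :: "'x \<Rightarrow> 'b set"
  assumes "finite \<Omega>" "finite X"
    and "(\<Sum>x\<in>X. real (card (\<Omega> - ok x)) ^ N) < real (card \<Omega>) ^ N"
  obtains f where "\<And>i. i < N \<Longrightarrow> f i \<in> \<Omega>" "\<And>x. x \<in> X \<Longrightarrow> \<exists>i<N. f i \<in> ok x"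
proof -
  let ?F = "{..<N} \<rightarrow>\<^sub>E \<Omega>"
  let ?B = "\<lambda>x. {..<N} \<rightarrow>\<^sub>E (\<Omega> - ok x)"
  have "card (\<Union>x\<in>X. ?B x) \<le> (\<Sum>x\<in>X. card (?B x))"
    by (rule card_UN_le[OF \<open>finite X\<close>])
  also have "\<dots> < card ?F"
    using assms(3) by (simp add: card_funcsetE flip: of_nat_power of_nat_sum)
  finally have "\<not> ?F \<subseteq> (\<Union>x\<in>X. ?B x)"
    using card_mono[of "\<Union>x\<in>X. ?B x" ?F] assms by (auto simp: finite_PiE)
  then obtain f where f: "f \<in> ?F" "\<And>x. x \<in> X \<Longrightarrow> f \<notin> ?B x"
    by blast
  show ?thesis
  proof (rule that)
    show "f i \<in> \<Omega>" if "i < N" for i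
      using f(1) that by auto
    show "\<exists>i<N. f i \<in> ok x" if "x \<in> X" for x
      using f(1) f(2)[OF that] by (auto simp: PiE_iff)
  qed
qed

lemma card_permutes_compose:
  assumes "q permutes S"
  shows "card {p. p permutes S \<and> R (p \<circ> q)} = card {p. p permutes S \<and> R p}"
proof (rule bij_betw_same_card[of "\<lambda>p. p \<circ> q"], rule bij_betw_byWitness[where f' = "\<lambda>p. p \<circ> inv q"])
  show "\<forall>p\<in>{p. p permutes S \<and> R (p \<circ> q)}. (p \<circ> q) \<circ> inv q = p"
    "\<forall>p\<in>{p. p permutes S \<and> R p}. (p \<circ> inv q) \<circ> q = p"
    using permutes_inv_o[OF assms] by (auto simp: o_assoc[symmetric])
  then show "(\<lambda>p. p \<circ> inv q) ` {p. p permutes S \<and> R p} \<subseteq> {p. p permutes S \<and> R (p \<circ> q)}"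
    using permutes_compose[OF permutes_inv[OF assms]] by auto
  show "(\<lambda>p. p \<circ> q) ` {p. p permutes S \<and> R (p \<circ> q)} \<subseteq> {p. p permutes S \<and> R p}"
    using permutes_compose[OF assms] by auto
qed

definition separates :: "('c \<Rightarrow> 'd::linorder) \<Rightarrow> 'c \<Rightarrow> 'c \<Rightarrow> 'c \<Rightarrow> 'c \<Rightarrow> bool" where
  "separates f a b c d \<longleftrightarrow>
    (f a < f c \<and> f a < f d \<and> f b < f c \<and> f b < f d) \<or> (f c < f a \<and> f c < f b \<and> f d < f a \<and> f d < f b)"

definition between :: "('c \<Rightarrow> 'd::linorder) \<Rightarrow> 'c \<Rightarrow> 'c \<Rightarrow> 'c \<Rightarrow> bool" where
  "between f a b c \<longleftrightarrow> (f b < f a \<and> f a < f c) \<or> (f c < f a \<and> f a < f b)"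

text \<open>Every permutation separates one of the three splittings of four points into two pairs,
  and by symmetry the three splittings are separated equally often.\<close>

lemma card_permutes_separates:
  fixes S :: "'c::linorder set"
  assumes "finite S" "{a, b, c, d} \<subseteq> S" "distinct [a, b, c, d]"
  shows "card {p. p permutes S} \<le> 3 * card {p. p permutes S \<and> separates p a b c d}"
proof -
  have "card {p. p permutes S \<and> separates p a c b d} = card {p. p permutes S \<and> separates p a b c d}"
    using assms card_permutes_compose[of "transpose b c" S "\<lambda>p. separates p a b c d"]
    by (auto simp: permutes_swap_id separates_def transpose_def)
  moreover have "card {p. p permutes S \<and> separates p a d c b} = card {p. p permutes S \<and> separates p a b c d}"
    using assms card_permutes_compose[of "transpose b d" S "\<lambda>p. separates p a b c d"]
    by (auto simp: permutes_swap_id separates_def transpose_def)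
  moreover have "card {p. p permutes S} \<le> card ({p. p permutes S \<and> separates p a b c d} \<union>
      {p. p permutes S \<and> separates p a c b d} \<union> {p. p permutes S \<and> separates p a d c b})"
  proof (intro card_mono subsetI)
    fix p assume "p \<in> {p. p permutes S}"
    then have p: "p permutes S" by simp
    have "p x \<noteq> p y" if "x \<noteq> y" for x y
      using permutes_inj[OF p] that by (auto dest: injD)
    then have "distinct [p a, p b, p c, p d]"
      using assms(3) by auto
    then have "separates p a b c d \<or> separates p a c b d \<or> separates p a d c b"
      unfolding separates_def distinct.simps list.set insert_iff empty_iff by (smt (verit) linorder_cases order.strict_trans)
    then show "p \<in> {p. p permutes S \<and> separates p a b c d} \<union>
      {p. p permutes S \<and> separates p a c b d} \<union> {p. p permutes S \<and> separates p a d c b}"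
      using p by auto
  qed (use finite_permutations[OF \<open>finite S\<close>] in \<open>auto intro: finite_subset[rotated]\<close>)
  moreover note card_Un_le[of "{p. p permutes S \<and> separates p a b c d} \<union> {p. p permutes S \<and> separates p a c b d}"
      "{p. p permutes S \<and> separates p a d c b}"]
    card_Un_le[of "{p. p permutes S \<and> separates p a b c d}" "{p. p permutes S \<and> separates p a c b d}"]
  ultimately show ?thesis by linarith
qed

lemma card_permutes_between:
  fixes S :: "'c::linorder set"
  assumes "finite S" "{a, b, c} \<subseteq> S" "distinct [a, b, c]"
  shows "card {p. p permutes S} \<le> 3 * card {p. p permutes S \<and> between p a b c}"
proof -
  have "card {p. p permutes S \<and> between p b a c} = card {p. p permutes S \<and> between p a b c}"
    using assms card_permutes_compose[of "transpose a b" S "\<lambda>p. between p a b c"]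
    by (auto simp: permutes_swap_id between_def transpose_def)
  moreover have "card {p. p permutes S \<and> between p c b a} = card {p. p permutes S \<and> between p a b c}"
    using assms card_permutes_compose[of "transpose a c" S "\<lambda>p. between p a b c"]
    by (auto simp: permutes_swap_id between_def transpose_def)
  moreover have "card {p. p permutes S} \<le> card ({p. p permutes S \<and> between p a b c} \<union>
      {p. p permutes S \<and> between p b a c} \<union> {p. p permutes S \<and> between p c b a})"
  proof (intro card_mono subsetI)
    fix p assume "p \<in> {p. p permutes S}"
    then have p: "p permutes S" by simp
    have "p x \<noteq> p y" if "x \<noteq> y" for x y
      using permutes_inj[OF p] that by (auto dest: injD)
    then have "distinct [p a, p b, p c]"
      using assms(3) by auto
    then have "between p a b c \<or> between p b a c \<or> between p c b a"
      by (auto simp: between_def)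
    then show "p \<in> {p. p permutes S \<and> between p a b c} \<union>
      {p. p permutes S \<and> between p b a c} \<union> {p. p permutes S \<and> between p c b a}"
      using p by auto
  qed (use finite_permutations[OF \<open>finite S\<close>] in \<open>auto intro: finite_subset[rotated]\<close>)
  moreover note card_Un_le[of "{p. p permutes S \<and> between p a b c} \<union> {p. p permutes S \<and> between p b a c}"
      "{p. p permutes S \<and> between p c b a}"]
    card_Un_le[of "{p. p permutes S \<and> between p a b c}" "{p. p permutes S \<and> between p b a c}"]
  ultimately show ?thesis by linarith
qed

lemma exists_separating_permutations:
  assumes "real K ^ 4 * (2 / 3) ^ M < 1"
  obtains \<tau> :: "nat \<Rightarrow> nat \<Rightarrow> nat" where
    "\<forall>a b c d. {a, b, c, d} \<subseteq> {..<K} \<and> distinct [a, b, c, d] \<longrightarrow> (\<exists>i<M. separates (\<tau> i) a b c d)"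
proof -
  define X where "X = {(a, b, c, d). {a, b, c, d} \<subseteq> {..<K} \<and> distinct [a, b, c, d]}"
  define \<Omega> where "\<Omega> = {p. p permutes {..<K}}"
  define ok where "ok = (\<lambda>(a, b, c, d). {p. p permutes {..<K} \<and> separates p a b c d})"
  have sub: "X \<subseteq> {..<K} \<times> {..<K} \<times> {..<K} \<times> {..<K}"
    by (auto simp: X_def)
  have fin: "finite X" and card: "card X \<le> K ^ 4"
    using finite_subset[OF sub] card_mono[OF _ sub]
    by (auto simp: card_cartesian_product numeral_eq_Suc mult.assoc)
  have \<Omega>: "finite \<Omega>" "\<Omega> \<noteq> {}"
    using finite_permutations by (auto simp: \<Omega>_def intro: permutes_id)
  have "real (card (\<Omega> - ok x)) \<le> 2 / 3 * card \<Omega>" if "x \<in> X" for x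
  proof -
    have "ok x \<subseteq> \<Omega>" by (auto simp: ok_def \<Omega>_def)
    moreover have "card \<Omega> \<le> 3 * card (ok x)"
      using that card_permutes_separates[of "{..<K}"] by (auto simp: X_def ok_def \<Omega>_def)
    ultimately show ?thesis
      using \<Omega> card_mono[of \<Omega> "ok x"] by (simp add: card_Diff_subset finite_subset of_nat_diff)
  qed
  then have "(\<Sum>x\<in>X. real (card (\<Omega> - ok x)) ^ M) \<le> (\<Sum>x\<in>X. (2 / 3 * card \<Omega>) ^ M)"
    by (intro sum_mono power_mono) auto
  also have "\<dots> \<le> real (K ^ 4) * (2 / 3 * card \<Omega>) ^ M"
    using card by (simp add: mult_right_mono flip: of_nat_power)
  also have "\<dots> = (real K ^ 4 * (2 / 3) ^ M) * real (card \<Omega>) ^ M"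
    by (simp only: power_mult_distrib of_nat_power mult.assoc)
  also have "\<dots> < 1 * real (card \<Omega>) ^ M"
    using assms \<Omega> by (intro mult_strict_right_mono) (auto simp: card_gt_0_iff)
  finally have "(\<Sum>x\<in>X. real (card (\<Omega> - ok x)) ^ M) < real (card \<Omega>) ^ M" by simp
  then obtain f where f: "\<And>x. x \<in> X \<Longrightarrow> \<exists>i<M. f i \<in> ok x"
    by (rule exists_family_meeting[OF \<Omega>(1) fin]) blast
  show ?thesis
  proof (rule that[of f], intro allI impI)
    fix a b c d assume "{a, b, c, d} \<subseteq> {..<K} \<and> distinct [a, b, c, d]"
    then show "\<exists>i<M. separates (f i) a b c d"
      using f[of "(a, b, c, d)"] by (auto simp: X_def ok_def)
  qed
qed

text \<open>A sign attached to each permutation will decide in which direction the vertices of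
  one colour class are listed; \<open>c\<close> is the colour shared by two edges with colours
  \<open>{b, c}\<close> and \<open>{c, d}\<close>, which is in the middle and correctly directed with probability \<open>1/6\<close>.\<close>

lemma exists_signed_permutations:
  assumes "real r ^ 3 * (5 / 6) ^ N + real r ^ 4 * (2 / 3) ^ N < 1"
  obtains \<sigma> :: "nat \<Rightarrow> nat \<Rightarrow> nat" and s :: "nat \<Rightarrow> bool" where
    "\<forall>b c d. {b, c, d} \<subseteq> {..<r} \<and> distinct [b, c, d] \<longrightarrow>
      (\<exists>i<N. if s i then \<sigma> i b < \<sigma> i c \<and> \<sigma> i c < \<sigma> i d else \<sigma> i d < \<sigma> i c \<and> \<sigma> i c < \<sigma> i b)"
    "\<forall>a b c d. {a, b, c, d} \<subseteq> {..<r} \<and> distinct [a, b, c, d] \<longrightarrow> (\<exists>i<N. separates (\<sigma> i) a b c d)"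
proof -
  define X where "X = {(b, c, d). {b, c, d} \<subseteq> {..<r} \<and> distinct [b, c, d]}"
  define Y where "Y = {(a, b, c, d). {a, b, c, d} \<subseteq> {..<r} \<and> distinct [a, b, c, d]}"
  define P where "P = {p. p permutes {..<r}}"
  define \<Omega> where "\<Omega> = P \<times> (UNIV :: bool set)"
  define okX where "okX = (\<lambda>(b, c, d). {p \<in> P. p b < p c \<and> p c < p d} \<times> {True} \<union>
    {p \<in> P. p d < p c \<and> p c < p b} \<times> {False})"
  define okY where "okY = (\<lambda>(a, b, c, d). {p \<in> P. separates p a b c d} \<times> (UNIV :: bool set))"
  define ok where "ok = case_sum okX okY"
  have subX: "X \<subseteq> {..<r} \<times> {..<r} \<times> {..<r}" and subY: "Y \<subseteq> {..<r} \<times> {..<r} \<times> {..<r} \<times> {..<r}"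
    by (auto simp: X_def Y_def)
  have fin: "finite X" "finite Y" and card: "card X \<le> r ^ 3" "card Y \<le> r ^ 4"
    using finite_subset[OF subX] card_mono[OF _ subX] finite_subset[OF subY] card_mono[OF _ subY]
    by (auto simp: card_cartesian_product numeral_eq_Suc mult.assoc)
  have P: "finite P" "P \<noteq> {}"
    using finite_permutations by (auto simp: P_def intro: permutes_id)
  then have \<Omega>: "finite \<Omega>" "\<Omega> \<noteq> {}" "card \<Omega> = 2 * card P"
    by (auto simp: \<Omega>_def card_cartesian_product)
  have boundX: "real (card (\<Omega> - okX x)) \<le> 5 / 6 * card \<Omega>" if "x \<in> X" for x
  proof -
    obtain b c d where x: "x = (b, c, d)" "{b, c, d} \<subseteq> {..<r}" "distinct [b, c, d]"
      using \<open>x \<in> X\<close> unfolding X_def by auto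
    have "{p \<in> P. between p c b d} = {p \<in> P. p b < p c \<and> p c < p d} \<union> {p \<in> P. p d < p c \<and> p c < p b}"
      by (auto simp: between_def)
    then have "card {p \<in> P. between p c b d} \<le>
        card {p \<in> P. p b < p c \<and> p c < p d} + card {p \<in> P. p d < p c \<and> p c < p b}"
      by (simp add: card_Un_le)
    also have "\<dots> = card (okX x)"
      using P by (auto simp: x okX_def card_cartesian_product
          intro!: trans[OF _ card_Un_disjoint[symmetric]])
    finally have "card {p \<in> P. between p c b d} \<le> card (okX x)" .
    moreover have "card P \<le> 3 * card {p \<in> P. between p c b d}"
      using card_permutes_between[of "{..<r}" c b d] x by (auto simp: P_def)
    ultimately have "card \<Omega> \<le> 6 * card (okX x)"
      using \<Omega> by linarith
    moreover have "okX x \<subseteq> \<Omega>" by (auto simp: x okX_def \<Omega>_def)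
    ultimately show ?thesis
      using \<Omega> card_mono[of \<Omega> "okX x"] by (simp add: card_Diff_subset finite_subset of_nat_diff)
  qed
  have boundY: "real (card (\<Omega> - okY x)) \<le> 2 / 3 * card \<Omega>" if "x \<in> Y" for x
  proof -
    have "okY x \<subseteq> \<Omega>" by (auto simp: okY_def \<Omega>_def)
    moreover have "card P \<le> 3 * card {p \<in> P. separates p a b c d}" if "x = (a, b, c, d)" for a b c d
      using that \<open>x \<in> Y\<close> card_permutes_separates[of "{..<r}"] by (auto simp: Y_def P_def)
    then have "card \<Omega> \<le> 3 * card (okY x)"
      using \<Omega> by (auto simp: okY_def card_cartesian_product split: prod.splits)
    ultimately show ?thesis
      using \<Omega> card_mono[of \<Omega> "okY x"] by (simp add: card_Diff_subset finite_subset of_nat_diff)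
  qed
  have "(\<Sum>x\<in>X <+> Y. real (card (\<Omega> - ok x)) ^ N) =
      (\<Sum>x\<in>X. real (card (\<Omega> - okX x)) ^ N) + (\<Sum>x\<in>Y. real (card (\<Omega> - okY x)) ^ N)"
    using fin by (simp add: sum.Plus ok_def)
  also have "\<dots> \<le> (\<Sum>x\<in>X. (5 / 6 * card \<Omega>) ^ N) + (\<Sum>x\<in>Y. (2 / 3 * card \<Omega>) ^ N)"
    by (intro add_mono sum_mono power_mono boundX boundY) auto
  also have "\<dots> \<le> real (r ^ 3) * (5 / 6 * card \<Omega>) ^ N + real (r ^ 4) * (2 / 3 * card \<Omega>) ^ N"
    using card by (simp add: add_mono mult_right_mono flip: of_nat_power)
  also have "\<dots> = (real r ^ 3 * (5 / 6) ^ N + real r ^ 4 * (2 / 3) ^ N) * real (card \<Omega>) ^ N"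
    by (simp only: power_mult_distrib of_nat_power mult.assoc distrib_right)
  also have "\<dots> < 1 * real (card \<Omega>) ^ N"
    using assms \<Omega>(1,2) by (intro mult_strict_right_mono) (auto simp: card_gt_0_iff)
  finally have "(\<Sum>x\<in>X <+> Y. real (card (\<Omega> - ok x)) ^ N) < real (card \<Omega>) ^ N" by simp
  then obtain f where f: "\<And>x. x \<in> X <+> Y \<Longrightarrow> \<exists>i<N. f i \<in> ok x"
    by (rule exists_family_meeting[OF \<Omega>(1) finite_Plus[OF fin]]) blast
  show ?thesis
  proof (rule that[of "\<lambda>i. snd (f i)" "\<lambda>i. fst (f i)"]; intro allI impI)
    fix b c d assume "{b, c, d} \<subseteq> {..<r} \<and> distinct [b, c, d]"
    then have "\<exists>i<N. f i \<in> okX (b, c, d)"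
      using f[of "Inl (b, c, d)"] by (auto simp: X_def ok_def)
    then show "\<exists>i<N. if snd (f i) then fst (f i) b < fst (f i) c \<and> fst (f i) c < fst (f i) d
        else fst (f i) d < fst (f i) c \<and> fst (f i) c < fst (f i) b"
      by (fastforce simp: okX_def)
  next
    fix a b c d assume "{a, b, c, d} \<subseteq> {..<r} \<and> distinct [a, b, c, d]"
    then have "\<exists>i<N. f i \<in> okY (a, b, c, d)"
      using f[of "Inr (a, b, c, d)"] by (auto simp: Y_def ok_def)
    then show "\<exists>i<N. separates (fst (f i)) a b c d"
      by (fastforce simp: okY_def)
  qed
qed

section \<open>Separating edges in different components\<close>

lemma separated_by_commute: "separated_by p i t e e' \<longleftrightarrow> separated_by p i t e' e"
  unfolding separated_by_def by blast

lemma separated_by_of_separates: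
  assumes "separates (\<lambda>u. p u i) v w x y"
  shows "\<exists>t. separated_by p i t {v, w} {x, y}"
proof -
  have *: "\<exists>t. separated_by p i t {v, w} {x, y}"
    if "p v i < p x i" "p v i < p y i" "p w i < p x i" "p w i < p y i" for v w x y
    using that unfolding separated_by_def
    by (intro exI[of _ "(max (p v i) (p w i) + min (p x i) (p y i)) / 2"])
      (auto simp: max_def min_def)
  show ?thesis
    using assms *[of v x y w] *[of x v w y] separated_by_commute[of p i _ "{v, w}"]
    unfolding separates_def by blast
qed

text \<open>The colours of consecutive vertices of a walk of constant colour sum alternate.\<close>

definition sum_rel :: "'a set set \<Rightarrow> ('a \<Rightarrow> nat) \<Rightarrow> nat \<Rightarrow> nat \<Rightarrow> ('a \<times> 'a) set" where
  "sum_rel E c r m = {(v, w). {v, w} \<in> E \<and> (c v + c w) mod r = m}"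

lemma sym_sum_rel: "sym (sum_rel E c r m)"
  by (auto simp: sum_rel_def sym_def insert_commute add.commute)

lemma add_mod_cancel_nat:
  fixes a b y r :: nat
  assumes "(a + y) mod r = (b + y) mod r" "a < r" "b < r"
  shows "a = b"
proof -
  have *: "a = b" if "(a + y) mod r = (b + y) mod r" "b \<le> a" "a < r" for a b :: nat
  proof -
    have "r dvd a - b"
      using that mod_eq_dvd_iff_nat[of "b + y" "a + y" r] by simp
    then show ?thesis
      using that dvd_imp_le[of r "a - b"] by (cases "a = b") auto
  qed
  show ?thesis
    using *[of a b] *[of b a] assms by (cases "b \<le> a") auto
qed

lemma exists_separating:
  assumes G: "simple_graph V E"
    and col: "\<And>v. v \<in> V \<Longrightarrow> c v < r"
    and proper: "\<And>v w. v \<in> V \<Longrightarrow> w \<in> V \<Longrightarrow> {v, w} \<in> E \<Longrightarrow> c v \<noteq> c w"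
    and local: "\<And>m v w x y. (v, w) \<in> sum_rel E c r m \<Longrightarrow> (x, y) \<in> sum_rel E c r m \<Longrightarrow>
      {v, w} \<inter> {x, y} = {} \<Longrightarrow> (v, x) \<in> (sum_rel E c r m)\<^sup>* \<Longrightarrow> \<exists>i<M. \<exists>t. separated_by q i t {v, w} {x, y}"
    and N: "real r ^ 3 * (5 / 6) ^ N + real r ^ 4 * (2 / 3) ^ N < 1"
  shows "\<exists>p. separating E (r + N + M) p"
proof -
  let ?Q = "sum_rel E c r"
  have fV: "finite V" using G by (simp add: simple_graph_def)
  define n where "n = card V"
  obtain num where bij: "bij_betw num V {0..<n}"
    using ex_bij_betw_finite_nat[OF fV] by (auto simp: n_def)
  then have num_less: "num v < n" if "v \<in> V" for v
    using that bij_betwE by fastforce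
  have num_inj: "num v \<noteq> num w" if "v \<in> V" "w \<in> V" "v \<noteq> w" for v w
    using that bij by (auto simp: bij_betw_def inj_on_def)
  obtain \<sigma> :: "nat \<Rightarrow> nat \<Rightarrow> nat" and s where
    mid: "\<forall>b c d. {b, c, d} \<subseteq> {..<r} \<and> distinct [b, c, d] \<longrightarrow>
      (\<exists>i<N. if s i then \<sigma> i b < \<sigma> i c \<and> \<sigma> i c < \<sigma> i d else \<sigma> i d < \<sigma> i c \<and> \<sigma> i c < \<sigma> i b)" and
    sep: "\<forall>a b c d. {a, b, c, d} \<subseteq> {..<r} \<and> distinct [a, b, c, d] \<longrightarrow> (\<exists>i<N. separates (\<sigma> i) a b c d)"
    by (rule exists_signed_permutations[OF N]) (rule that; assumption)
  define comp where "comp m v = (LEAST k. \<exists>w. (v, w) \<in> (?Q m)\<^sup>* \<and> w \<in> V \<and> num w = k)" for m v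
  define key where "key i v = \<sigma> i (c v) * n + (if s i then num v else n - 1 - num v)" for i v
  define p where "p v j = (if j < r then real (comp j v)
    else if j < r + N then real (key (j - r) v) else q v (j - (r + N)))" for v j
  have sym: "sym ((?Q m)\<^sup>*)" for m
    by (intro sym_rtrancl sym_sum_rel)
  have comp_eq: "comp m v = comp m w" if "(v, w) \<in> (?Q m)\<^sup>*" for m v w
  proof -
    have "(v, u) \<in> (?Q m)\<^sup>* \<longleftrightarrow> (w, u) \<in> (?Q m)\<^sup>*" for u
      using that symD[OF sym that] by (meson rtrancl_trans)
    then show ?thesis by (simp add: comp_def)
  qed
  have compD: "\<exists>w. (v, w) \<in> (?Q m)\<^sup>* \<and> w \<in> V \<and> num w = comp m v" if "v \<in> V" for m v
    unfolding comp_def by (rule LeastI_ex) (use that in blast)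
  have comp_neq: "comp m v \<noteq> comp m w" if "(v, w) \<notin> (?Q m)\<^sup>*" "v \<in> V" "w \<in> V" for m v w
  proof
    assume eq: "comp m v = comp m w"
    obtain v' w' where "(v, v') \<in> (?Q m)\<^sup>*" "(w, w') \<in> (?Q m)\<^sup>*" "v' \<in> V" "w' \<in> V" "num v' = num w'"
      using compD[OF \<open>v \<in> V\<close>, of m] compD[OF \<open>w \<in> V\<close>, of m] eq by metis
    then have "v' = w'" using num_inj by metis
    then have "(v, w) \<in> (?Q m)\<^sup>*"
      using \<open>(v, v') \<in> _\<close> symD[OF sym \<open>(w, w') \<in> _\<close>] by simp
    then show False using that by simp
  qed
  have key_less: "key i v < key i w" if "\<sigma> i (c v) < \<sigma> i (c w)" "v \<in> V" "w \<in> V" for i v w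
  proof -
    have "key i v < \<sigma> i (c v) * n + n"
      using num_less[OF \<open>v \<in> V\<close>] by (auto simp: key_def)
    also have "\<dots> = Suc (\<sigma> i (c v)) * n" by simp
    also have "\<dots> \<le> \<sigma> i (c w) * n"
      using that by (intro mult_le_mono1) simp
    also have "\<dots> \<le> key i w" by (simp add: key_def)
    finally show ?thesis .
  qed
  have key_less': "if s i then key i v < key i w else key i w < key i v"
    if "c v = c w" "num v < num w" "w \<in> V" for i v w
    using that num_less[OF \<open>w \<in> V\<close>] by (auto simp: key_def)
  have at_key: "\<exists>j<r + N + M. \<exists>t. separated_by p j t {v, w} {x, y}"
    if "i < N" "separates (key i) v w x y" for i v w x y
    using that separated_by_of_separates[of p "r + i" v w x y]
    by (intro exI[of _ "r + i"]) (simp add: p_def separates_def)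
  have shared: "\<exists>j<r + N + M. \<exists>t. separated_by p j t {v, w} {x, y}"
    if "{v, w, x, y} \<subseteq> V" "c v = c x" "distinct [c v, c w, c y]" "num v < num x" for v w x y
  proof -
    obtain i where i: "i < N" "if s i then \<sigma> i (c w) < \<sigma> i (c v) \<and> \<sigma> i (c v) < \<sigma> i (c y)
        else \<sigma> i (c y) < \<sigma> i (c v) \<and> \<sigma> i (c v) < \<sigma> i (c w)"
    proof -
      have "{c w, c v, c y} \<subseteq> {..<r} \<and> distinct [c w, c v, c y]"
        using \<open>{v, w, x, y} \<subseteq> V\<close> \<open>distinct _\<close> col by auto
      then show thesis
        using mid that by blast
    qed
    have k: "if s i then key i v < key i x else key i x < key i v"
      using that by (intro key_less') auto
    have "separates (key i) v w x y"
    proof (cases "s i")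
      case True
      then have "key i w < key i v" "key i x < key i y" "key i v < key i x"
        using i k that by (auto intro: key_less)
      then show ?thesis by (simp add: separates_def)
    next
      case False
      then have "key i y < key i x" "key i v < key i w" "key i x < key i v"
        using i k that by (auto intro: key_less)
      then show ?thesis by (simp add: separates_def)
    qed
    then show ?thesis using at_key i by blast
  qed
  have shared': "\<exists>j<r + N + M. \<exists>t. separated_by p j t {v, w} {x, y}"
    if "{v, w, x, y} \<subseteq> V" "c v = c x" "distinct [c v, c w, c y]" "v \<noteq> x" for v w x y
  proof (cases "num v < num x")
    case False
    then have "num x < num v" using num_inj that by (metis insert_subset linorder_neqE_nat)
    then have "\<exists>j<r + N + M. \<exists>t. separated_by p j t {x, y} {v, w}"
      using that by (intro shared) auto
    then show ?thesis using separated_by_commute by metis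
  qed (use shared that in blast)
  have main: "\<exists>j<r + N + M. \<exists>t. separated_by p j t {v, w} {x, y}"
    if "{v, w} \<in> E" "{x, y} \<in> E" "{v, w} \<inter> {x, y} = {}" for v w x y
  proof -
    have V: "{v, w, x, y} \<subseteq> V" and neq: "c v \<noteq> c w" "c x \<noteq> c y"
      using that G proper by (auto simp: simple_graph_def)
    have lt: "c v < r" "c w < r" "c x < r" "c y < r"
      using V col by auto
    show ?thesis
    proof (cases "(c v + c w) mod r = (c x + c y) mod r")
      case True
      define m where "m = (c v + c w) mod r"
      have Q: "(v, w) \<in> ?Q m" "(x, y) \<in> ?Q m"
        using that True by (auto simp: sum_rel_def m_def)
      show ?thesis
      proof (cases "(v, x) \<in> (?Q m)\<^sup>*")
        case True
        then obtain i t where "i < M" "separated_by q i t {v, w} {x, y}"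
          using local[OF Q \<open>{v, w} \<inter> {x, y} = {}\<close>] by blast
        then have "r + N + i < r + N + M \<and> separated_by p (r + N + i) t {v, w} {x, y}"
          by (simp add: separated_by_def p_def)
        then show ?thesis by blast
      next
        case False
        have "comp m v \<noteq> comp m x" "comp m w = comp m v" "comp m y = comp m x"
          using comp_neq[OF False] comp_eq[of w v m] comp_eq[of y x m] V
            symD[OF sym_sum_rel Q(1)] symD[OF sym_sum_rel Q(2)]
          by auto
        moreover have "m < r"
          using lt by (simp add: m_def)
        ultimately have "separates (\<lambda>u. p u m) v w x y"
          by (auto simp: separates_def p_def)
        then show ?thesis
          using separated_by_of_separates[of p m v w x y] \<open>m < r\<close> by (intro exI[of _ m]) auto
      qed
    next
      case False
      show ?thesis
      proof (cases "distinct [c v, c w, c x, c y]")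
        case True
        then obtain i where "i < N" "separates (\<sigma> i) (c v) (c w) (c x) (c y)"
          using sep[rule_format, of "c v" "c w" "c x" "c y"] lt by auto
        moreover from this have "separates (key i) v w x y"
          using V unfolding separates_def by (auto intro: key_less)
        ultimately show ?thesis
          using at_key by blast
      next
        case nd: False
        have n1: "\<not> (c v = c x \<and> c w = c y)"
          using False by auto
        have n2: "\<not> (c v = c y \<and> c w = c x)"
          using False by (auto simp: add.commute)
        have ne: "v \<noteq> x" "v \<noteq> y" "w \<noteq> x" "w \<noteq> y"
          using that by auto
        consider "c v = c x" "c w \<noteq> c y" | "c v = c y" "c w \<noteq> c x"
          | "c w = c x" "c v \<noteq> c y" | "c w = c y" "c v \<noteq> c x"
          using nd neq n1 n2 by auto
        then show ?thesis
        proof cases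
          case 1
          then show ?thesis using neq ne V shared'[of v w x y] by auto
        next
          case 2
          then show ?thesis using neq ne V shared'[of v w y x] by (auto simp: insert_commute)
        next
          case 3
          then show ?thesis using neq ne V shared'[of w v x y] by (auto simp: insert_commute)
        next
          case 4
          then show ?thesis using neq ne V shared'[of w v y x] by (auto simp: insert_commute)
        qed
      qed
    qed
  qed
  have "separating E (r + N + M) p"
    unfolding separating_def
  proof (intro ballI impI)
    fix e e' assume "e \<in> E" "e' \<in> E" "e \<inter> e' = {}"
    moreover from this obtain v w x y where "e = {v, w}" "e' = {x, y}"
      using G unfolding simple_graph_def card_2_iff by metis
    ultimately show "\<exists>i<r + N + M. \<exists>t. separated_by p i t e e'"
      using main by blast
  qed
  then show ?thesis by blast
qed

section \<open>Separating edges in the same component\<close>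

definition near :: "'a set set \<Rightarrow> ('a \<times> 'a) set" where
  "near E = {(u, w). u = w \<or> {u, w} \<in> E}"

lemma sym_near_relpow: "sym (near E ^^ k)"
proof (induction k)
  case (Suc k)
  have "sym (near E)"
    by (auto simp: near_def sym_def insert_commute)
  then have "near E O near E ^^ k = (near E ^^ k O near E)\<inverse>"
    using Suc by (simp add: converse_relcomp sym_conv_converse_eq)
  then show ?case
    by (simp add: relpow_commute sym_conv_converse_eq)
qed (simp add: sym_Id)

lemma near_relpow_mono:
  assumes "(u, w) \<in> near E ^^ j" "j \<le> k"
  shows "(u, w) \<in> near E ^^ k"
  using assms(2,1)
proof (induction k rule: dec_induct)
  case (step k)
  then have "(u, w) \<in> near E ^^ k" "(w, w) \<in> near E"
    by (auto simp: near_def)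
  then show ?case by auto
qed

lemma card_near_relpow:
  assumes deg: "\<And>v. finite (neighbours E v) \<and> card (neighbours E v) \<le> \<Delta>"
  shows "finite ((near E ^^ k) `` {v}) \<and> card ((near E ^^ k) `` {v}) \<le> (\<Delta> + 1) ^ k"
proof (induction k)
  case (Suc k)
  let ?B = "(near E ^^ k) `` {v}"
  have eq: "(near E ^^ Suc k) `` {v} = (\<Union>u\<in>?B. insert u (neighbours E u))"
    by (auto simp: near_def neighbours_def)
  have "card (insert u (neighbours E u)) \<le> \<Delta> + 1" for u
    using deg[of u] by (simp add: card_insert_if)
  then have sum: "(\<Sum>u\<in>?B. card (insert u (neighbours E u))) \<le> card ?B * (\<Delta> + 1)"
    using sum_bounded_above[of ?B "\<lambda>u. card (insert u (neighbours E u))" "\<Delta> + 1"] by simp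
  have "card (\<Union>u\<in>?B. insert u (neighbours E u)) \<le> (\<Sum>u\<in>?B. card (insert u (neighbours E u)))"
    using Suc by (intro card_UN_le) simp
  also note sum
  also have "card ?B * (\<Delta> + 1) \<le> (\<Delta> + 1) ^ k * (\<Delta> + 1)"
    using Suc by (intro mult_right_mono) auto
  also have "\<dots> = (\<Delta> + 1) ^ Suc k"
    by simp
  finally have "card (\<Union>u\<in>?B. insert u (neighbours E u)) \<le> (\<Delta> + 1) ^ Suc k" .
  then show ?case
    unfolding eq using Suc deg by simp
qed simp

lemma exists_distance_colouring:
  assumes "finite V"
    and deg: "\<And>v. finite (neighbours E v) \<and> card (neighbours E v) \<le> \<Delta>"
  obtains c :: "'a \<Rightarrow> nat" where "\<And>v. v \<in> V \<Longrightarrow> c v < (\<Delta> + 1) ^ k"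
    "\<And>v w. v \<in> V \<Longrightarrow> w \<in> V \<Longrightarrow> v \<noteq> w \<Longrightarrow> (v, w) \<in> near E ^^ k \<Longrightarrow> c v \<noteq> c w"
proof -
  have card: "card ((near E ^^ k) `` {v} - {v}) < (\<Delta> + 1) ^ k" for v
  proof -
    have "(v, v) \<in> near E ^^ k"
      by (rule near_relpow_mono[where j = 0]) auto
    then have "v \<in> (near E ^^ k) `` {v}" by simp
    then show ?thesis
      using card_near_relpow[OF deg, of k v] card_Diff1_less[of "(near E ^^ k) `` {v}" v] by linarith
  qed
  show ?thesis
    by (rule exists_greedy_colouring[OF \<open>finite V\<close> sym_near_relpow[of k E], of "(\<Delta> + 1) ^ k"])
      (use card card_near_relpow[OF deg] that in blast)+
qed

text \<open>A shortest path in \<open>sum_rel\<close> between two edges, prolonged by the other endpoints of the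
  two edges, is an alternating path, so its length is less than \<open>L\<close>.\<close>

lemma near_of_sum_rel_connected:
  fixes c :: "'a \<Rightarrow> nat"
  assumes V: "\<And>v w. {v, w} \<in> E \<Longrightarrow> v \<in> V \<and> v \<noteq> w"
    and col: "\<And>v. v \<in> V \<Longrightarrow> c v < r"
    and no_path: "\<And>xs. set xs \<subseteq> V \<Longrightarrow> distinct xs \<Longrightarrow> walk E xs \<Longrightarrow> length xs = L \<Longrightarrow> \<not> alternating c xs"
    and e: "(v, w) \<in> sum_rel E c r m" "(x, y) \<in> sum_rel E c r m" "{v, w} \<inter> {x, y} = {}"
    and conn: "(v, x) \<in> (sum_rel E c r m)\<^sup>*"
  shows "5 \<le> L \<and> {v, w} \<times> {x, y} \<subseteq> near E ^^ (L - 2)"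
proof -
  let ?Q = "sum_rel E c r m"
  define R where "R k \<longleftrightarrow> (\<exists>a\<in>{v, w}. \<exists>b\<in>{x, y}. (a, b) \<in> ?Q ^^ k)" for k
  obtain k0 where "(v, x) \<in> ?Q ^^ k0"
    using conn by (auto simp: rtrancl_power)
  then have "R k0" by (auto simp: R_def)
  define k where "k = (LEAST k. R k)"
  have "R k" unfolding k_def by (rule LeastI[of R, OF \<open>R k0\<close>])
  have minimal: "k \<le> j" if "R j" for j
    unfolding k_def using that by (rule Least_le)
  obtain a b where ab: "a \<in> {v, w}" "b \<in> {x, y}" "(a, b) \<in> ?Q ^^ k"
    using \<open>R k\<close> by (auto simp: R_def)
  then obtain f where f: "f 0 = a" "f k = b" "\<And>i. i < k \<Longrightarrow> (f i, f (Suc i)) \<in> ?Q"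
    by (auto simp: relpow_fun_conv)
  have seg: "(f i, f j) \<in> ?Q ^^ (j - i)" if "i \<le> j" "j \<le> k" for i j
    using that f(3) by (auto simp: relpow_fun_conv intro!: exI[of _ "\<lambda>n. f (i + n)"])
  obtain a' where a': "{a, a'} = {v, w}" "(a', a) \<in> ?Q" "a' \<noteq> a"
    using ab(1) e(1) symD[OF sym_sum_rel e(1)] V by (auto simp: sum_rel_def)
  obtain b' where b': "{b, b'} = {x, y}" "(b, b') \<in> ?Q" "b' \<noteq> b"
    using ab(2) e(2) symD[OF sym_sum_rel e(2)] V by (auto simp: sum_rel_def)
  have inj: "inj_on f {..k}"
  proof (rule linorder_inj_onI')
    fix i j assume ij: "i \<in> {..k}" "j \<in> {..k}" "i < j"
    show "f i \<noteq> f j"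
    proof
      assume "f i = f j"
      then have "(a, f i) \<in> ?Q ^^ i" "(f i, b) \<in> ?Q ^^ (k - j)"
        using seg[of 0 i] seg[of j k] ij f(1,2) by auto
      then have "(a, b) \<in> ?Q ^^ (i + (k - j))"
        unfolding relpow_add by (rule relcompI)
      then have "R (i + (k - j))"
        using ab by (auto simp: R_def)
      then show False
        using minimal ij by fastforce
    qed
  qed
  have a'_notin: "a' \<noteq> f i" if "i \<le> k" for i
  proof
    assume eq: "a' = f i"
    then have "i \<noteq> 0" using a'(3) f(1) by metis
    have "R (k - i)"
      using seg[of i k] that ab(2) a'(1) f(2) eq by (auto simp: R_def)
    then show False
      using minimal[of "k - i"] \<open>i \<noteq> 0\<close> that by simp
  qed
  have b'_notin: "b' \<noteq> f i" if "i \<le> k" for i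
  proof
    assume eq: "b' = f i"
    then have "i \<noteq> k" using b'(3) f(2) by metis
    have "R i"
      using seg[of 0 i] that ab(1) b'(1) f(1) eq by (auto simp: R_def)
    then show False
      using minimal[of i] \<open>i \<noteq> k\<close> that by simp
  qed
  have "a' \<noteq> b'" using a'(1) b'(1) e(3) by blast
  have "k \<noteq> 0"
  proof
    assume "k = 0"
    then have "a = b" using f by simp
    then show False using ab e(3) by blast
  qed
  define xs where "xs = a' # map f [0..<Suc k] @ [b']"
  have len: "length xs = k + 3" by (simp add: xs_def)
  have dist: "distinct xs"
  proof -
    have "{0..<Suc k} = {..k}" by auto
    moreover have "a' \<notin> f ` {..k}" "b' \<notin> f ` {..k}"
      using a'_notin b'_notin by auto
    ultimately show ?thesis
      using inj \<open>a' \<noteq> b'\<close> by (simp add: xs_def distinct_map del: upt_Suc)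
  qed
  have QW: "successively (\<lambda>x y. (x, y) \<in> ?Q) xs"
  proof -
    have "successively (\<lambda>x y. (x, y) \<in> ?Q) (map f [0..<Suc k])"
      using f(3) by (auto simp: successively_conv_nth simp del: upt_Suc)
    moreover have "hd (map f [0..<Suc k]) = a" "last (map f [0..<Suc k]) = b"
      using f by (auto simp: hd_map last_map simp del: upt_Suc)
    ultimately show ?thesis
      using a' b' by (simp add: xs_def successively_Cons successively_append_iff del: upt_Suc)
  qed
  have "k + 3 < L"
  proof (rule ccontr)
    assume "\<not> k + 3 < L"
    define ys where "ys = take L xs"
    have ys: "length ys = L" "distinct ys" "set ys \<subseteq> set xs"
      using \<open>\<not> k + 3 < L\<close> len dist by (auto simp: ys_def dest: in_set_takeD)
    have Qn: "(xs ! i, xs ! Suc i) \<in> ?Q" if "Suc i < length xs" for i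
      using successively_nth[OF QW that] .
    have inV: "xs ! i \<in> V" if "i < length xs" for i
    proof (cases i)
      case 0
      then show ?thesis
        using Qn[of 0] V len by (auto simp: sum_rel_def)
    next
      case (Suc j)
      then have "{xs ! i, xs ! j} \<in> E"
        using Qn[of j] that by (auto simp: sum_rel_def insert_commute)
      then show ?thesis using V by blast
    qed
    have "alternating c ys"
      unfolding alternating_def
    proof (intro allI impI)
      fix i assume i: "i + 2 < length ys"
      then have i': "i + 2 < length xs" "ys ! i = xs ! i" "ys ! (i + 2) = xs ! (i + 2)"
        using ys(1) by (auto simp: ys_def)
      have "(c (xs ! i) + c (xs ! Suc i)) mod r = (c (xs ! (i + 2)) + c (xs ! Suc i)) mod r"
        using Qn[of i] Qn[of "Suc i"] i' by (simp add: sum_rel_def add.commute)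
      then have "c (xs ! i) = c (xs ! (i + 2))"
        by (rule add_mod_cancel_nat) (use i' in \<open>auto intro!: col inV\<close>)
      then show "c (ys ! i) = c (ys ! (i + 2))"
        by (simp only: i')
    qed
    moreover have "walk E ys"
      using Qn ys(1) by (auto simp: successively_conv_nth ys_def sum_rel_def)
    moreover have "set ys \<subseteq> V"
    proof
      fix u assume "u \<in> set ys"
      then obtain i where "i < length xs" "xs ! i = u"
        using ys(3) by (meson in_set_conv_nth subsetD)
      then show "u \<in> V" using inV by blast
    qed
    ultimately show False
      using no_path ys by blast
  qed
  have Qnear: "?Q \<subseteq> near E" by (auto simp: sum_rel_def near_def)
  have "(a, b) \<in> near E ^^ k"
    using f Qnear by (auto simp: relpow_fun_conv intro!: exI[of _ f])
  have "(s, t) \<in> near E ^^ (L - 2)" if "s \<in> {v, w}" "t \<in> {x, y}" for s t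
  proof (rule near_relpow_mono)
    have "(s, a) \<in> near E"
      using that(1) a' Qnear by (auto simp: near_def)
    moreover have "(b, t) \<in> near E"
      using that(2) b' Qnear by (auto simp: near_def)
    ultimately have "(s, t) \<in> near E ^^ (1 + k + 1)"
      using \<open>(a, b) \<in> near E ^^ k\<close> unfolding relpow_add relpow_1 by (intro relcompI)
    then show "(s, t) \<in> near E ^^ (k + 2)" by simp
    show "k + 2 \<le> L - 2" using \<open>k + 3 < L\<close> by simp
  qed
  then show ?thesis
    using \<open>k + 3 < L\<close> \<open>k \<noteq> 0\<close> by auto
qed

lemma separation_dimension_le:
  assumes G: "simple_graph V E"
    and deg: "\<And>v. finite (neighbours E v) \<and> card (neighbours E v) \<le> \<Delta>"
    and col: "\<And>v. v \<in> V \<Longrightarrow> c v < r"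
    and proper: "\<And>v w. v \<in> V \<Longrightarrow> w \<in> V \<Longrightarrow> {v, w} \<in> E \<Longrightarrow> c v \<noteq> c w"
    and no_path: "\<And>xs. set xs \<subseteq> V \<Longrightarrow> distinct xs \<Longrightarrow> walk E xs \<Longrightarrow> length xs = L \<Longrightarrow> \<not> alternating c xs"
    and N: "real r ^ 3 * (5 / 6) ^ N + real r ^ 4 * (2 / 3) ^ N < 1"
    and M: "L < 5 \<or> real ((\<Delta> + 1) ^ (L - 2)) ^ 4 * (2 / 3) ^ M < 1"
    and "r > 0"
  shows "separation_dimension E \<le> r + N + M"
proof -
  have fV: "finite V"
    using G by (simp add: simple_graph_def)
  have V: "v \<in> V \<and> v \<noteq> w" if "{v, w} \<in> E" for v w
    using G that by (fastforce simp: simple_graph_def)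
  define conn where "conn m v w x y \<longleftrightarrow> (v, w) \<in> sum_rel E c r m \<and> (x, y) \<in> sum_rel E c r m \<and>
    {v, w} \<inter> {x, y} = {} \<and> (v, x) \<in> (sum_rel E c r m)\<^sup>*" for m v w x y
  have near_conn: "5 \<le> L \<and> {v, w} \<times> {x, y} \<subseteq> near E ^^ (L - 2)" if "conn m v w x y" for m v w x y
    by (rule near_of_sum_rel_connected[OF V col no_path]) (use that in \<open>auto simp: conn_def\<close>)
  have "\<exists>q :: 'a \<Rightarrow> nat \<Rightarrow> real. \<forall>m v w x y. conn m v w x y \<longrightarrow>
      (\<exists>i<M. \<exists>t. separated_by q i t {v, w} {x, y})"
  proof (cases "L < 5")
    case True
    show ?thesis
    proof (intro exI[of _ "\<lambda>_ _. 0"] allI impI)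
      fix m v w x y assume "conn m v w x y"
      from near_conn[OF this] True
      show "\<exists>i<M. \<exists>t. separated_by (\<lambda>_ _. 0) i t {v, w} {x, y}" by simp
    qed
  next
    case False
    obtain \<psi> :: "'a \<Rightarrow> nat" where \<psi>: "\<And>v. v \<in> V \<Longrightarrow> \<psi> v < (\<Delta> + 1) ^ (L - 2)"
      "\<And>v w. v \<in> V \<Longrightarrow> w \<in> V \<Longrightarrow> v \<noteq> w \<Longrightarrow> (v, w) \<in> near E ^^ (L - 2) \<Longrightarrow> \<psi> v \<noteq> \<psi> w"
      by (rule exists_distance_colouring[OF fV deg, where k = "L - 2"]) blast
    obtain \<tau> :: "nat \<Rightarrow> nat \<Rightarrow> nat" where
      \<tau>: "\<forall>a b c d. {a, b, c, d} \<subseteq> {..<(\<Delta> + 1) ^ (L - 2)} \<and> distinct [a, b, c, d] \<longrightarrow>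
        (\<exists>i<M. separates (\<tau> i) a b c d)"
      using exists_separating_permutations[of "(\<Delta> + 1) ^ (L - 2)" M] M False by blast
    have "\<exists>i<M. \<exists>t. separated_by (\<lambda>v i. real (\<tau> i (\<psi> v))) i t {v, w} {x, y}"
      if conn: "conn m v w x y" for m v w x y
    proof -
      have edges: "{v, w} \<in> E" "{x, y} \<in> E"
        using conn by (auto simp: conn_def sum_rel_def)
      then have inV: "v \<in> V" "w \<in> V" "x \<in> V" "y \<in> V" and ne: "v \<noteq> w" "x \<noteq> y"
        using V[of v w] V[of w v] V[of x y] V[of y x] by (auto simp: insert_commute)
      have near: "{v, w} \<times> {x, y} \<subseteq> near E ^^ (L - 2)" and "{v, w} \<inter> {x, y} = {}"
        using near_conn[OF conn] conn by (auto simp: conn_def)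
      have "(u, t) \<in> near E ^^ (L - 2)" if "{u, t} \<in> E" for u t
        by (rule near_relpow_mono[where j = 1]) (use that False in \<open>simp_all add: near_def\<close>)
      then have "(v, w) \<in> near E ^^ (L - 2)" "(x, y) \<in> near E ^^ (L - 2)"
        using edges by blast+
      then have "distinct [\<psi> v, \<psi> w, \<psi> x, \<psi> y]"
        using near inV ne \<open>{v, w} \<inter> {x, y} = {}\<close> \<psi>(2) by auto
      then obtain i where "i < M" "separates (\<tau> i) (\<psi> v) (\<psi> w) (\<psi> x) (\<psi> y)"
        using \<tau> \<psi>(1) inV by (metis empty_subsetI insert_subset lessThan_iff)
      moreover from this have "separates (\<lambda>u. real (\<tau> i (\<psi> u))) v w x y"
        by (simp add: separates_def)
      ultimately show ?thesis
        using separated_by_of_separates[of "\<lambda>v i. real (\<tau> i (\<psi> v))" i v w x y] by auto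
    qed
    then show ?thesis
      by (intro exI[of _ "\<lambda>v i. real (\<tau> i (\<psi> v))"] allI impI)
  qed
  then obtain q :: "'a \<Rightarrow> nat \<Rightarrow> real" where q: "\<forall>m v w x y. conn m v w x y \<longrightarrow>
      (\<exists>i<M. \<exists>t. separated_by q i t {v, w} {x, y})" ..
  have "\<exists>p. separating E (r + N + M) p"
    by (rule exists_separating[OF G col proper q[rule_format] N]) (auto simp: conn_def)
  then show ?thesis
    unfolding separation_dimension_def using \<open>r > 0\<close> by (intro Least_le) simp
qed

section \<open>Choice of the parameters\<close>

lemma power_condition_mono:
  assumes "real r0 ^ 3 * (5 / 6) ^ N + real r0 ^ 4 * (2 / 3) ^ N < 1" "r \<le> r0"
  shows "real r ^ 3 * (5 / 6) ^ N + real r ^ 4 * (2 / 3) ^ N < 1"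
proof -
  have "real r ^ 3 * (5 / 6) ^ N + real r ^ 4 * (2 / 3) ^ N \<le>
      real r0 ^ 3 * (5 / 6) ^ N + real r0 ^ 4 * (2 / 3) ^ N"
    using assms(2) by (intro add_mono mult_right_mono power_mono) auto
  then show ?thesis using assms(1) by linarith
qed

lemma small_parameters:
  assumes "1 \<le> \<Delta>" "\<Delta> \<le> 13"
  obtains N where "real (\<Delta> * \<Delta> + 1) ^ 3 * (5 / 6) ^ N + real (\<Delta> * \<Delta> + 1) ^ 4 * (2 / 3) ^ N < 1"
    "\<Delta> * \<Delta> + 1 + N < 20 * \<Delta>"
proof -
  consider "\<Delta> = 1" | "\<Delta> = 2" | "\<Delta> = 3" | "4 \<le> \<Delta>" "\<Delta> \<le> 5" | "\<Delta> = 6" | "7 \<le> \<Delta>" "\<Delta> \<le> 13"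
    using assms by linarith
  then show ?thesis
  proof cases
    case 1
    then show ?thesis by (intro that[of 16]) (simp_all add: power_divide)
  next
    case 2
    then show ?thesis by (intro that[of 31]) (simp_all add: power_divide)
  next
    case 3
    then show ?thesis by (intro that[of 42]) (simp_all add: power_divide)
  next
    case 4
    then have *: "\<Delta> = 4 \<or> \<Delta> = 5" by linarith
    show ?thesis
      by (rule that[of 58, OF power_condition_mono[of 26]]) (use * in \<open>auto simp: power_divide\<close>)
  next
    case 5
    then show ?thesis by (intro that[of 70]) (simp_all add: power_divide)
  next
    case 6
    then have *: "\<Delta> = 7 \<or> \<Delta> = 8 \<or> \<Delta> = 9 \<or> \<Delta> = 10 \<or> \<Delta> = 11 \<or> \<Delta> = 12 \<or> \<Delta> = 13" by linarith
    show ?thesis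
      by (rule that[of 89, OF power_condition_mono[of 170]]) (use * in \<open>auto simp: power_divide\<close>)
  qed
qed

lemma large_parameters:
  assumes "\<Delta> \<ge> 14"
  obtains h N M where "h \<ge> 3" "h * \<Delta> \<le> 4 ^ (2 * h - 3)"
    "real (6 * \<Delta>) ^ 3 * (5 / 6) ^ N + real (6 * \<Delta>) ^ 4 * (2 / 3) ^ N < 1"
    "real ((\<Delta> + 1) ^ (2 * h - 2)) ^ 4 * (2 / 3) ^ M < 1"
    "6 * \<Delta> + N + M < 20 * \<Delta>"
proof -
  have mono: "real ((\<Delta> + 1) ^ k) ^ 4 * (2 / 3) ^ M < 1"
    if "real (D ^ k) ^ 4 * (2 / 3) ^ M < 1" "\<Delta> + 1 \<le> D" for D k M
  proof -
    have "real ((\<Delta> + 1) ^ k) ^ 4 * (2 / 3) ^ M \<le> real (D ^ k) ^ 4 * (2 / 3) ^ M"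
      using that(2) by (intro mult_right_mono power_mono of_nat_mono) auto
    then show ?thesis using that(1) by linarith
  qed
  consider "\<Delta> \<le> 17" | "18 \<le> \<Delta>" "\<Delta> \<le> 21" | "22 \<le> \<Delta>" "\<Delta> \<le> 32" | "33 \<le> \<Delta>" "\<Delta> \<le> 256" | "256 < \<Delta>"
    by linarith
  then show ?thesis
  proof cases
    case 1
    show ?thesis
      by (rule that[of 3 80 115, OF _ _ power_condition_mono[of 102] mono[of 18]]) (use 1 assms in \<open>simp_all add: power_divide\<close>)
  next
    case 2
    show ?thesis
      by (rule that[of 3 84 122, OF _ _ power_condition_mono[of 126] mono[of 22]]) (use 2 in \<open>simp_all add: power_divide\<close>)
  next
    case 3
    show ?thesis
      by (rule that[of 4 91 208, OF _ _ power_condition_mono[of 192] mono[of 33]]) (use 3 in \<open>simp_all add: power_divide\<close>)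
  next
    case 4
    show ?thesis
      by (rule that[of 4 125 329, OF _ _ power_condition_mono[of 1536] mono[of 257]]) (use 4 in \<open>simp_all add: power_divide\<close>)
  next
    case 5
    define h where "h = (LEAST h. \<Delta> \<le> 4 ^ h)"
    have "\<Delta> < 4 ^ \<Delta>" by (rule less_exp[THEN less_le_trans]) (simp add: power_mono)
    then have up: "\<Delta> \<le> 4 ^ h"
      unfolding h_def by (intro LeastI[of "\<lambda>h. \<Delta> \<le> 4 ^ h" \<Delta>]) simp
    have low: "\<not> \<Delta> \<le> 4 ^ j" if "j < h" for j
      using that not_less_Least unfolding h_def by blast
    have "h \<ge> 5"
    proof (rule ccontr)
      assume "\<not> h \<ge> 5"
      then have "(4::nat) ^ h \<le> 4 ^ 4" by (intro power_increasing) auto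
      then show False using up 5 by simp
    qed
    then obtain j where j: "h = j + 5" by (metis add.commute le_Suc_ex)
    have low': "4 ^ (j + 4) < \<Delta>"
      using low[of "j + 4"] j by simp
    have "j + 5 \<le> 4 ^ (j + 2)" by (induction j) auto
    then have "(j + 5) * \<Delta> \<le> 4 ^ (j + 2) * 4 ^ (j + 5)"
      using up j by (intro mult_mono) auto
    also have "\<dots> = 4 ^ (2 * h - 3)"
    proof -
      have "2 * h - 3 = (j + 2) + (j + 5)" by (simp add: j)
      then show ?thesis by (simp only: power_add)
    qed
    finally have h1: "h * \<Delta> \<le> 4 ^ (2 * h - 3)" by (simp add: j)
    have half: "(2 / 3 :: real) ^ 2 < 1 / 2" "(5 / 6 :: real) ^ 4 < 1 / 2"
      by (simp_all add: power_divide)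
    define N where "N = 4 * (6 * h + 10)"
    define M where "M = 2 * ((2 * h + 1) * (8 * (h - 1)))"
    have r: "real (6 * \<Delta>) \<le> 2 ^ (2 * h + 3)"
    proof -
      have "6 * \<Delta> \<le> 8 * 4 ^ h" using up by simp
      also have "\<dots> = 2 ^ (2 * h + 3)"
        by (simp add: power_add power_mult)
      finally show ?thesis
        using of_nat_mono[of "6 * \<Delta>" "2 ^ (2 * h + 3)", where 'a = real] by simp
    qed
    have r3: "real (6 * \<Delta>) ^ 3 \<le> 2 ^ (6 * h + 9)"
      using power_mono[OF r, of 3] by (simp flip: power_mult add: algebra_simps)
    have r4: "real (6 * \<Delta>) ^ 4 \<le> 2 ^ (8 * h + 12)"
      using power_mono[OF r, of 4] by (simp flip: power_mult add: algebra_simps)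
    have "(5 / 6 :: real) ^ N = ((5 / 6) ^ 4) ^ (6 * h + 10)"
      by (simp only: N_def power_mult)
    also have "\<dots> \<le> (1 / 2) ^ (6 * h + 10)"
      using half by (intro power_mono) auto
    finally have p5: "(5 / 6 :: real) ^ N \<le> (1 / 2) ^ (6 * h + 10)" .
    have "N = 2 * (12 * h + 20)" by (simp add: N_def)
    then have "(2 / 3 :: real) ^ N = ((2 / 3) ^ 2) ^ (12 * h + 20)"
      by (simp only: power_mult)
    also have "\<dots> \<le> (1 / 2) ^ (12 * h + 20)"
      using half by (intro power_mono) auto
    also have "\<dots> \<le> (1 / 2) ^ (8 * h + 14)"
      by (intro power_decreasing) auto
    finally have p2: "(2 / 3 :: real) ^ N \<le> (1 / 2) ^ (8 * h + 14)" .
    have "real (6 * \<Delta>) ^ 3 * (5 / 6) ^ N \<le> 2 ^ (6 * h + 9) * (1 / 2) ^ (6 * h + 10)"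
      using r3 p5 by (intro mult_mono) auto
    also have "\<dots> = 1 / 2" by (simp add: power_divide power_add)
    finally have a: "real (6 * \<Delta>) ^ 3 * (5 / 6) ^ N \<le> 1 / 2" .
    have "real (6 * \<Delta>) ^ 4 * (2 / 3) ^ N \<le> 2 ^ (8 * h + 12) * (1 / 2) ^ (8 * h + 14)"
      using r4 p2 by (intro mult_mono) auto
    also have "\<dots> = 1 / 4" by (simp add: power_divide power_add)
    finally have b: "real (6 * \<Delta>) ^ 4 * (2 / 3) ^ N \<le> 1 / 4" .
    have h3: "real (6 * \<Delta>) ^ 3 * (5 / 6) ^ N + real (6 * \<Delta>) ^ 4 * (2 / 3) ^ N < 1"
      using a b by linarith
    have "\<Delta> + 1 \<le> 2 * 4 ^ h" using up 5 by simp
    also have "\<dots> = 2 ^ (2 * h + 1)"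
      by (simp add: power_mult)
    finally have "\<Delta> + 1 \<le> 2 ^ (2 * h + 1)" .
    then have "real (\<Delta> + 1) \<le> 2 ^ (2 * h + 1)"
      using of_nat_mono[of "\<Delta> + 1" "2 ^ (2 * h + 1)", where 'a = real] by simp
    then have "real (\<Delta> + 1) ^ (8 * (h - 1)) \<le> (2 ^ (2 * h + 1)) ^ (8 * (h - 1))"
      by (intro power_mono) auto
    moreover have "real ((\<Delta> + 1) ^ (2 * h - 2)) ^ 4 = real (\<Delta> + 1) ^ (8 * (h - 1))"
    proof -
      have "(2 * h - 2) * 4 = 8 * (h - 1)" by simp
      then show ?thesis by (simp only: of_nat_power flip: power_mult)
    qed
    ultimately have K: "real ((\<Delta> + 1) ^ (2 * h - 2)) ^ 4 \<le> 2 ^ ((2 * h + 1) * (8 * (h - 1)))"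
      by (simp only: power_mult)
    have "(2 / 3 :: real) ^ M = ((2 / 3) ^ 2) ^ ((2 * h + 1) * (8 * (h - 1)))"
      by (simp only: M_def power_mult)
    also have "\<dots> < (1 / 2) ^ ((2 * h + 1) * (8 * (h - 1)))"
      using half \<open>h \<ge> 5\<close> by (intro power_strict_mono) auto
    finally have "real ((\<Delta> + 1) ^ (2 * h - 2)) ^ 4 * (2 / 3) ^ M <
        2 ^ ((2 * h + 1) * (8 * (h - 1))) * (1 / 2) ^ ((2 * h + 1) * (8 * (h - 1)))"
      using K by (intro mult_le_less_imp_less) auto
    also have "\<dots> = 1" by (simp add: power_divide)
    finally have h4: "real ((\<Delta> + 1) ^ (2 * h - 2)) ^ 4 * (2 / 3) ^ M < 1" .
    have "N + M \<le> 32 * j * j + 328 * j + 864"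
      by (simp add: N_def M_def j algebra_simps)
    also have "\<dots> < 14 * 4 ^ (j + 4)"
    proof (induction j)
      case (Suc j)
      moreover have "(14::nat) * 4 ^ (Suc j + 4) = 4 * (14 * 4 ^ (j + 4))"
        by (simp add: power_add)
      moreover have "32 * Suc j * Suc j + 328 * Suc j + 864 = 32 * j * j + 392 * j + 1224"
        by (simp add: algebra_simps)
      ultimately show ?case by linarith
    qed simp
    also have "\<dots> \<le> 14 * \<Delta>" using low' by simp
    finally have h5: "6 * \<Delta> + N + M < 20 * \<Delta>" by simp
    show ?thesis
      by (rule that[OF _ h1 h3 h4 h5]) (use \<open>h \<ge> 5\<close> in simp)
  qed
qed

lemma exists_square_colouring:
  assumes "finite V"
    and deg: "\<And>v. finite (neighbours E v) \<and> card (neighbours E v) \<le> \<Delta>"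
  obtains c :: "'a \<Rightarrow> nat" where "\<And>v. v \<in> V \<Longrightarrow> c v < \<Delta> * \<Delta> + 1"
    "\<And>v w. v \<in> V \<Longrightarrow> w \<in> V \<Longrightarrow> v \<noteq> w \<Longrightarrow>
      {v, w} \<in> E \<or> (\<exists>u. {v, u} \<in> E \<and> {u, w} \<in> E) \<Longrightarrow> c v \<noteq> c w"
proof -
  define R where "R = {(v, w). {v, w} \<in> E \<or> (\<exists>u. {v, u} \<in> E \<and> {u, w} \<in> E)}"
  have "sym R"
    unfolding R_def sym_def by (auto simp: insert_commute)
  have R: "finite (R `` {v}) \<and> card (R `` {v} - {v}) < \<Delta> * \<Delta> + 1" for v
  proof -
    let ?B = "\<Union>u\<in>neighbours E v. insert u (neighbours E u - {v})"
    have sub: "R `` {v} - {v} \<subseteq> ?B"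
      by (auto simp: R_def neighbours_def)
    have fin: "finite ?B" using deg by auto
    have one: "card (insert u (neighbours E u - {v})) \<le> \<Delta>" if "u \<in> neighbours E v" for u
    proof -
      have "v \<in> neighbours E u"
        using that by (simp add: neighbours_def insert_commute)
      then have "card (neighbours E u - {v}) < card (neighbours E u)"
        using deg by (intro card_Diff1_less) auto
      then show ?thesis
        using deg[of u] card_insert_le_m1[of \<Delta> "neighbours E u - {v}" u] by (auto simp: card_insert_if)
    qed
    have "card (R `` {v} - {v}) \<le> card ?B"
      by (rule card_mono[OF fin sub])
    also have "\<dots> \<le> (\<Sum>u\<in>neighbours E v. card (insert u (neighbours E u - {v})))"
      using deg by (intro card_UN_le) simp
    also have "\<dots> \<le> card (neighbours E v) * \<Delta>"
      using sum_bounded_above[OF one] by simp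
    also have "\<dots> \<le> \<Delta> * \<Delta>"
      using deg by (intro mult_right_mono) auto
    finally have "card (R `` {v} - {v}) < \<Delta> * \<Delta> + 1" by simp
    moreover have "finite (R `` {v})"
      using finite_subset[OF sub fin] by (metis finite_Diff_insert Diff_empty)
    ultimately show ?thesis by blast
  qed
  show ?thesis
    by (rule exists_greedy_colouring[OF \<open>finite V\<close> \<open>sym R\<close> R]) (use that in \<open>unfold R_def, blast\<close>)
qed

lemma neighbours_bound:
  assumes "simple_graph V E" "max_degree V E = \<Delta>"
  shows "finite (neighbours E v) \<and> card (neighbours E v) \<le> \<Delta>"
proof (cases "v \<in> V")
  case True
  have "finite V" and sub: "E \<subseteq> Pow V"
    using assms(1) by (auto simp: simple_graph_def)
  then have "finite E" by (meson finite_Pow_iff finite_subset)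
  have "card (neighbours E v) \<le> degree E v"
    unfolding degree_def
  proof (rule card_inj_on_le[of "\<lambda>w. {v, w}"])
    show "inj_on (\<lambda>w. {v, w}) (neighbours E v)"
      by (auto simp: inj_on_def doubleton_eq_iff)
  qed (use \<open>finite E\<close> in \<open>auto simp: neighbours_def\<close>)
  also have "\<dots> \<le> \<Delta>"
    using assms(2) True \<open>finite V\<close> unfolding max_degree_def by (auto intro: Max_ge)
  finally show ?thesis
    using finite_subset[of "neighbours E v" V] sub \<open>finite V\<close> by (auto simp: neighbours_def)
next
  case False
  then have "neighbours E v = {}"
    using assms(1) by (auto simp: neighbours_def simple_graph_def)
  then show ?thesis by simp
qed

theorem theorem1:
  fixes V :: "'a set" and E :: "'a set set" and \<Delta> :: nat
  assumes "\<Delta> \<ge> 1"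
    and "simple_graph V E"
    and "max_degree V E = \<Delta>"
  shows "separation_dimension E < 20 * \<Delta>"
proof -
  have fV: "finite V"
    using assms(2) by (simp add: simple_graph_def)
  have deg: "finite (neighbours E v) \<and> card (neighbours E v) \<le> \<Delta>" for v
    by (rule neighbours_bound[OF assms(2,3)])
  have loopless: "{v} \<notin> E" for v
    using assms(2) by (auto simp: simple_graph_def)
  show ?thesis
  proof (cases "\<Delta> \<le> 13")
    case True
    obtain N where N: "real (\<Delta> * \<Delta> + 1) ^ 3 * (5 / 6) ^ N + real (\<Delta> * \<Delta> + 1) ^ 4 * (2 / 3) ^ N < 1"
      "\<Delta> * \<Delta> + 1 + N < 20 * \<Delta>"
      using small_parameters[OF assms(1) True] by blast
    obtain c :: "'a \<Rightarrow> nat" where c: "\<And>v. v \<in> V \<Longrightarrow> c v < \<Delta> * \<Delta> + 1"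
      "\<And>v w. v \<in> V \<Longrightarrow> w \<in> V \<Longrightarrow> v \<noteq> w \<Longrightarrow>
        {v, w} \<in> E \<or> (\<exists>u. {v, u} \<in> E \<and> {u, w} \<in> E) \<Longrightarrow> c v \<noteq> c w"
      using exists_square_colouring[OF fV deg] by blast
    have "separation_dimension E \<le> \<Delta> * \<Delta> + 1 + N + 0"
    proof (rule separation_dimension_le[OF assms(2) deg c(1) _ _ N(1)])
      show "c v \<noteq> c w" if "v \<in> V" "w \<in> V" "{v, w} \<in> E" for v w
        using that c(2)[of v w] loopless[of v] by (metis insert_absorb2)
      show "\<not> alternating c xs" if "set xs \<subseteq> V" "distinct xs" "walk E xs" "length xs = 3" for xs
      proof -
        obtain x y z where "xs = [x, y, z]"
          using \<open>length xs = 3\<close> by (auto simp: length_Suc_conv numeral_eq_Suc)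
        then have "c x \<noteq> c z"
          using that by (intro c(2)) auto
        then show ?thesis
          using \<open>xs = _\<close> by (auto simp: alternating_def)
      qed
    qed auto
    then show ?thesis using N(2) by simp
  next
    case False
    then have "\<Delta> \<ge> 14" by simp
    then obtain h N M where p: "h \<ge> 3" "h * \<Delta> \<le> 4 ^ (2 * h - 3)"
      "real (6 * \<Delta>) ^ 3 * (5 / 6) ^ N + real (6 * \<Delta>) ^ 4 * (2 / 3) ^ N < 1"
      "real ((\<Delta> + 1) ^ (2 * h - 2)) ^ 4 * (2 / 3) ^ M < 1"
      "6 * \<Delta> + N + M < 20 * \<Delta>"
      by (rule large_parameters)
    obtain c :: "'a \<Rightarrow> nat" where c: "\<And>v. v \<in> V \<Longrightarrow> c v < 6 * \<Delta>"
      "\<And>v w. v \<in> V \<Longrightarrow> w \<in> V \<Longrightarrow> {v, w} \<in> E \<Longrightarrow> c v \<noteq> c w"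
      "\<And>xs. set xs \<subseteq> V \<Longrightarrow> distinct xs \<Longrightarrow> walk E xs \<Longrightarrow> length xs = 2 * h \<Longrightarrow> \<not> alternating c xs"
      by (rule exists_path_colouring[OF fV deg loopless assms(1) _ p(2)]) (use p(1) in simp, blast)
    have "separation_dimension E \<le> 6 * \<Delta> + N + M"
      by (rule separation_dimension_le[OF assms(2) deg c(1,2,3) p(3) disjI2[OF p(4)]]) (use assms(1) in simp_all)
    then show ?thesis using p(5) by simp
  qed
qed

end
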